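(* For every composition $\alpha$, \[ \mathcal{P}_\alpha = \sum_T (1-q)^{n(T)}\,M_{\mathrm{content}(T)}, \] the sum over all immaculate tableaux $T$ of shape $\alpha$ (whose content is a composition). Moreover, at $q=1$ one has $\mathcal{P}_\alpha=M_\alpha$ and at $q=0$ one has $\mathcal{P}_\alpha=\mathfrak{S}^*_\alpha$.
   Context: Work over $\mathbb{Q}(q)$. $\mathrm{NSym}$ is the free associative algebra on $H_1,H_2,\dots$ ($H_0=1$, $H_{-r}=0$ for $r>0$), graded dual to $\mathrm{QSym}$ via $\langle H_{\alpha_1}\cdots H_{\alpha_k},M_\beta\rangle=\delta_{\alpha\beta}$ ($M_\beta$ monomial quasisymmetric functions), coproduct $\Delta(H_j)=\sum_iH_i\otimes H_{j-i}$. For $F\in\mathrm{QSym}$, $F^\perp$ satisfies $\langle F^\perp(H),G\rangle=\langle H,FG\rangle$. $F_i=\sum_{\gamma\models i}M_\gamma$ ($F_0=1$), $F_{1^i}=M_{1^i}$. Let $\mathbb{B}_m=\sum_{i\ge0}(-1)^iH_{m+i}F_{1^i}^\perp$, $\mathfrak{S}_\alpha=\mathbb{B}_{\alpha_1}\cdots\mathbb{B}_{\alpha_m}(1)$ with dual basis $\{\mathfrak{S}^*_\alpha\}$ in $\mathrm{QSym}$, $\widetilde{\mathbb{B}}_m(f)=\sum_{i\ge0}q^i\mathbb{B}_{m+i}(F_i^\perp(f))$, and $\mathcal{Q}'_\alpha=\widetilde{\mathbb{B}}_{\alpha_1}\cdots\widetilde{\mathbb{B}}_{\alpha_m}(1)$;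 the $\mathcal{Q}'_\alpha$ (over compositions) form a basis of $\mathbb{Q}(q)\otimes\mathrm{NSym}$ and $\{\mathcal{P}_\alpha\}$ is the dual basis of $\mathbb{Q}(q)\otimes\mathrm{QSym}$. An immaculate tableau of shape $\alpha$ and content $\beta$ (compositions) is a filling of the diagram of $\alpha$ (left-justified rows of lengths $\alpha_i$, row 1 on top) with positive integers, $\beta_i$ equal to $i$, rows weakly increasing, first column strictly increasing top to bottom. $n(T)=\sum_{j}(d_j(T)-1)$ over rows $j$, where $d_j(T)$ is the number of distinct entries in row $j$. *)

theory Defs
  imports Complex_Main
    "HOL-Library.Poly_Mapping"
    "HOL-Computational_Algebra.Polynomial"
    "HOL-Computational_Algebra.Fraction_Field"
begin

section \<open>Compositions\<close>

typedef composition = "{xs :: nat list. \<forall>x \<in> set xs. 0 < x}"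
  morphisms parts Composition
  by (rule exI[of _ "[]"]) simp

setup_lifting type_definition_composition

instantiation composition :: monoid_add
begin

lift_definition zero_composition :: composition is "[]" by simp

lift_definition plus_composition :: "composition \<Rightarrow> composition \<Rightarrow> composition" is append
  by auto

instance by standard (transfer; simp)+

end

lift_definition one_part :: "nat \<Rightarrow> composition" is "\<lambda>n. if n = 0 then [] else [n]"
  by (auto split: if_splits)

lift_definition ones :: "nat \<Rightarrow> composition" is "\<lambda>i. replicate i 1"
  by simp

definition comps :: "nat \<Rightarrow> composition set" where
  "comps n = {\<gamma>. sum_list (parts \<gamma>) = n}"

lemma finite_comps: "finite (comps n)"
proof -
  have len: "length xs \<le> sum_list xs" if "\<forall>x \<in> set xs. 0 < x" for xs :: "nat list"
    using that by (induction xs) auto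
  have "parts ` comps n \<subseteq> {xs. set xs \<subseteq> {..n} \<and> length xs \<le> n}"
    using len parts by (fastforce simp: comps_def dest: member_le_sum_list)
  then have "finite (parts ` comps n)"
    by (rule finite_subset) (rule finite_lists_length_le, simp)
  then show ?thesis
    by (rule finite_imageD) (simp add: inj_on_def parts_inject)
qed


section \<open>Noncommutative symmetric functions\<close>

text \<open>The free associative algebra on \<open>H\<^sub>1, H\<^sub>2, \<dots>\<close> is the monoid algebra of the free monoid
  on the positive integers, that is, of compositions under concatenation.\<close>

type_synonym 'k nsym = "composition \<Rightarrow>\<^sub>0 'k"

definition nconst :: "'k \<Rightarrow> 'k::ring_1 nsym" where
  "nconst c = Poly_Mapping.single 0 c"

definition H :: "int \<Rightarrow> 'k::ring_1 nsym" where
  "H r = (if r < 0 then 0 else Poly_Mapping.single (one_part (nat r)) 1)"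

lemma H_0: "H 0 = 1"
proof -
  have "one_part 0 = 0" by transfer simp
  then show ?thesis by (simp add: H_def)
qed

text \<open>Concatenation of compositions is the product of the generators.\<close>

lemma prod_list_H:
  "(\<Prod>a\<leftarrow>parts \<alpha>. H (int a)) = (Poly_Mapping.single \<alpha> 1 :: 'k::ring_1 nsym)"
proof -
  have gen: "(\<Prod>a\<leftarrow>xs. H (int a)) = (Poly_Mapping.single (Composition xs) 1 :: 'k nsym)"
    if "\<forall>x \<in> set xs. 0 < x" for xs
    using that
  proof (induction xs)
    case Nil
    have "Composition [] = 0" by (simp add: zero_composition_def)
    then show ?case by simp
  next
    case (Cons x xs)
    then have "one_part x + Composition xs = Composition (x # xs)"
      by (simp add: plus_composition.abs_eq one_part.abs_eq eq_onp_def)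
    with Cons show ?case by (simp add: H_def Poly_Mapping.mult_single)
  qed
  show ?thesis using gen[of "parts \<alpha>"] parts[of \<alpha>] by (simp add: parts_inverse)
qed


section \<open>Formal power series in infinitely many commuting variables\<close>

text \<open>A monomial in \<open>x\<^sub>0, x\<^sub>1, \<dots>\<close> is its exponent vector.\<close>

typedef 'k series = "UNIV :: ((nat \<Rightarrow>\<^sub>0 nat) \<Rightarrow> 'k) set"
  morphisms scoeff Series ..

setup_lifting type_definition_series

lemma series_eqI: "(\<And>m. scoeff F m = scoeff G m) \<Longrightarrow> F = G"
  by (simp add: scoeff_inject[symmetric] fun_eq_iff)

definition splits :: "(nat \<Rightarrow>\<^sub>0 nat) \<Rightarrow> ((nat \<Rightarrow>\<^sub>0 nat) \<times> (nat \<Rightarrow>\<^sub>0 nat)) set" where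
  "splits m = {(a, b). a + b = m}"

lemma finite_splits: "finite (splits m)"
proof -
  let ?B = "{f. \<forall>x. (x \<in> Poly_Mapping.keys m \<longrightarrow> f x \<in> {..Max (Poly_Mapping.lookup m ` Poly_Mapping.keys m)}) \<and> (x \<notin> Poly_Mapping.keys m \<longrightarrow> f x = 0)}"
  have le: "Poly_Mapping.lookup a x \<le> Poly_Mapping.lookup m x" if "(a, b) \<in> splits m" for a b x
    using that by (auto simp: splits_def lookup_add)
  have "(\<lambda>p. Poly_Mapping.lookup (fst p)) ` splits m \<subseteq> ?B"
  proof clarsimp
    fix a b x assume ab: "(a, b) \<in> splits m"
    show "(x \<in> Poly_Mapping.keys m \<longrightarrow> Poly_Mapping.lookup a x \<le> Max (Poly_Mapping.lookup m ` Poly_Mapping.keys m)) \<and> (x \<notin> Poly_Mapping.keys m \<longrightarrow> Poly_Mapping.lookup a x = 0)"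
    proof (intro conjI impI)
      assume "x \<in> Poly_Mapping.keys m"
      then have "Poly_Mapping.lookup m x \<le> Max (Poly_Mapping.lookup m ` Poly_Mapping.keys m)" by simp
      with le[OF ab, of x] show "Poly_Mapping.lookup a x \<le> Max (Poly_Mapping.lookup m ` Poly_Mapping.keys m)" by linarith
    next
      assume "x \<notin> Poly_Mapping.keys m"
      then show "Poly_Mapping.lookup a x = 0" using le[OF ab, of x] by (simp add: in_keys_iff)
    qed
  qed
  moreover have "finite ?B" by (rule finite_set_of_finite_funs) simp_all
  ultimately have "finite ((\<lambda>p. Poly_Mapping.lookup (fst p)) ` splits m)" by (rule finite_subset)
  moreover have "inj_on (\<lambda>p. Poly_Mapping.lookup (fst p)) (splits m)"
    by (auto simp: inj_on_def splits_def lookup_inject)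
  ultimately show ?thesis by (rule finite_imageD)
qed

instantiation series :: (comm_ring_1) comm_ring_1
begin

lift_definition zero_series :: "'a series" is "\<lambda>_. 0" .
lift_definition one_series :: "'a series" is "\<lambda>m. if m = 0 then 1 else 0" .
lift_definition plus_series :: "'a series \<Rightarrow> 'a series \<Rightarrow> 'a series"
  is "\<lambda>F G m. F m + G m" .
lift_definition minus_series :: "'a series \<Rightarrow> 'a series \<Rightarrow> 'a series"
  is "\<lambda>F G m. F m - G m" .
lift_definition uminus_series :: "'a series \<Rightarrow> 'a series" is "\<lambda>F m. - F m" .
lift_definition times_series :: "'a series \<Rightarrow> 'a series \<Rightarrow> 'a series"
  is "\<lambda>F G m. \<Sum>(a, b)\<in>splits m. F a * G b" .

instance
proof
  fix F G K :: "'a series"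
  show "F + G + K = F + (G + K)" "F + G = G + F" "0 + F = F" "- F + F = 0" "F - G = F + - G"
    by (transfer; simp add: fun_eq_iff algebra_simps)+
  show "F * G = G * F"
  proof (rule series_eqI)
    fix m
    show "scoeff (F * G) m = scoeff (G * F) m"
      unfolding times_series.rep_eq
      by (rule sum.reindex_bij_witness[where i = prod.swap and j = prod.swap])
        (auto simp: splits_def ac_simps)
  qed
  show "(F + G) * K = F * K + G * K"
    by transfer (simp add: fun_eq_iff case_prod_unfold distrib_right sum.distrib)
  show "1 * F = F"
  proof (rule series_eqI)
    fix m
    have "scoeff (1 * F) m = (\<Sum>(a, b)\<in>splits m. if a = 0 then scoeff F b else 0)"
      unfolding times_series.rep_eq one_series.rep_eq by (rule sum.cong) auto
    also have "\<dots> = (\<Sum>(a, b)\<in>{(0 :: nat \<Rightarrow>\<^sub>0 nat, m)}. if a = 0 then scoeff F b else 0)"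
      by (rule sum.mono_neutral_right[OF finite_splits]) (auto simp: splits_def split: if_splits)
    finally show "scoeff (1 * F) m = scoeff F m" by simp
  qed
  show "F * G * K = F * (G * K)"
  proof (rule series_eqI)
    fix m
    have "scoeff (F * G * K) m
        = (\<Sum>(p, c)\<in>splits m. \<Sum>(a, b)\<in>splits p. scoeff F a * scoeff G b * scoeff K c)"
      by (simp add: times_series.rep_eq case_prod_unfold sum_distrib_right)
    also have "\<dots> = (\<Sum>((p, c), (a, b))\<in>Sigma (splits m) (\<lambda>(p, c). splits p).
        scoeff F a * scoeff G b * scoeff K c)"
      by (subst sum.Sigma[symmetric]) (auto simp: finite_splits case_prod_unfold)
    also have "\<dots> = (\<Sum>((a, p), (b, c))\<in>Sigma (splits m) (\<lambda>(a, p). splits p).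
        scoeff F a * scoeff G b * scoeff K c)"
      by (rule sum.reindex_bij_witness
          [where i = "\<lambda>((a, p), (b, c)). ((a + b, c), (a, b))"
             and j = "\<lambda>((p, c), (a, b)). ((a, b + c), (b, c))"])
        (auto simp: splits_def ac_simps)
    also have "\<dots> = (\<Sum>(a, p)\<in>splits m. \<Sum>(b, c)\<in>splits p. scoeff F a * scoeff G b * scoeff K c)"
      by (subst sum.Sigma[symmetric]) (auto simp: finite_splits case_prod_unfold)
    also have "\<dots> = scoeff (F * (G * K)) m"
      by (simp add: times_series.rep_eq case_prod_unfold sum_distrib_left mult.assoc)
    finally show "scoeff (F * G * K) m = scoeff (F * (G * K)) m" .
  qed
  show "(0 :: 'a series) \<noteq> 1"
  proof
    assume "(0 :: 'a series) = 1"
    then have "scoeff (0 :: 'a series) 0 = scoeff (1 :: 'a series) 0" by simp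
    then show False by (simp add: zero_series.rep_eq one_series.rep_eq)
  qed
qed

end

lift_definition scale :: "'k::comm_ring_1 \<Rightarrow> 'k series \<Rightarrow> 'k series" is "\<lambda>c F m. c * F m" .


section \<open>Quasisymmetric functions\<close>

text \<open>The nonzero exponents of a monomial, in increasing order of the variables.\<close>

definition exps :: "(nat \<Rightarrow>\<^sub>0 nat) \<Rightarrow> nat list" where
  "exps m = map (Poly_Mapping.lookup m) (sorted_list_of_set (Poly_Mapping.keys m))"

definition QSym :: "'k::comm_ring_1 series set" where
  "QSym = {F. (\<exists>d. \<forall>m. scoeff F m \<noteq> 0 \<longrightarrow> sum_list (exps m) \<le> d) \<and>
              (\<forall>m m'. exps m = exps m' \<longrightarrow> scoeff F m = scoeff F m')}"

lift_definition M :: "composition \<Rightarrow> 'k::comm_ring_1 series"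
  is "\<lambda>\<beta> m. if exps m = parts \<beta> then 1 else 0" .

definition Fq :: "nat \<Rightarrow> 'k::comm_ring_1 series" where
  "Fq i = (\<Sum>\<gamma>\<in>comps i. M \<gamma>)"

text \<open>The coefficient of \<open>M\<^sub>\<alpha>\<close> in a quasisymmetric function is its coefficient at the monomial
  with exponent vector \<open>(\<alpha>\<^sub>1, \<dots>, \<alpha>\<^sub>k, 0, 0, \<dots>)\<close>, which is \<^term>\<open>Poly_Mapping.nth (parts \<alpha>)\<close>.
  So this is the bilinear pairing for which the \<open>H\<^sub>\<alpha>\<close> and the \<open>M\<^sub>\<beta>\<close> are dual
  bases, see \<open>pairing_H_M\<close> below.\<close>

definition pairing :: "'k::comm_ring_1 nsym \<Rightarrow> 'k series \<Rightarrow> 'k" where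
  "pairing h F = (\<Sum>\<alpha>\<in>Poly_Mapping.keys h. Poly_Mapping.lookup h \<alpha> * scoeff F (Poly_Mapping.nth (parts \<alpha>)))"

lemma exps_nth: "exps (Poly_Mapping.nth (parts \<alpha>)) = parts \<alpha>"
proof -
  have "Poly_Mapping.keys (Poly_Mapping.nth (parts \<alpha>)) = {..<length (parts \<alpha>)}"
    using parts[of \<alpha>]
    by (auto simp: in_keys_iff nth.rep_eq nth_default_def simp del: keys_nth split: if_splits)
  then show ?thesis
    by (auto simp: exps_def lessThan_atLeast0 nth.rep_eq nth_default_def intro!: nth_equalityI)
qed

lemma pairing_H_M:
  "pairing (\<Prod>a\<leftarrow>parts \<alpha>. H (int a)) (M \<beta>) = (if \<alpha> = \<beta> then 1 else 0 :: 'k::comm_ring_1)"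
  by (simp add: prod_list_H pairing_def M.rep_eq exps_nth parts_inject)

definition perp :: "'k::comm_ring_1 series \<Rightarrow> 'k nsym \<Rightarrow> 'k nsym" where
  "perp F h = (THE g. \<forall>G\<in>QSym. pairing g G = pairing h (F * G))"

text \<open>The dual basis of a basis of NSym, within QSym.\<close>

definition dual :: "(composition \<Rightarrow> 'k::comm_ring_1 nsym) \<Rightarrow> composition \<Rightarrow> 'k series" where
  "dual b \<alpha> = (THE F. F \<in> QSym \<and> (\<forall>\<beta>. pairing (b \<beta>) F = (if \<beta> = \<alpha> then 1 else 0)))"


section \<open>Creation operators and the two families of functions\<close>

text \<open>For each argument only finitely many terms of the operator series are nonzero, and
  \<^const>\<open>Sum_any\<close> sums these.\<close>

definition BB :: "int \<Rightarrow> 'k::comm_ring_1 nsym \<Rightarrow> 'k nsym" where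
  "BB m f = Sum_any (\<lambda>i::nat. (-1) ^ i * H (m + int i) * perp (M (ones i)) f)"

definition immaculate :: "composition \<Rightarrow> 'k::comm_ring_1 nsym" where
  "immaculate \<alpha> = foldr (\<lambda>a. BB (int a)) (parts \<alpha>) 1"

definition dual_immaculate :: "composition \<Rightarrow> 'k::comm_ring_1 series" where
  "dual_immaculate = dual immaculate"

text \<open>Here \<open>q\<close> is any element of the coefficient ring; the functions over \<open>\<rat>(q)\<close> are the case
  where it is the indeterminate \<open>qvar\<close>.\<close>

definition BBq :: "'k \<Rightarrow> int \<Rightarrow> 'k::comm_ring_1 nsym \<Rightarrow> 'k nsym" where
  "BBq q m f = Sum_any (\<lambda>i::nat. nconst (q ^ i) * BB (m + int i) (perp (Fq i) f))"

definition Qprime :: "'k \<Rightarrow> composition \<Rightarrow> 'k::comm_ring_1 nsym" where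
  "Qprime q \<alpha> = foldr (\<lambda>a. BBq q (int a)) (parts \<alpha>) 1"

definition calP :: "'k \<Rightarrow> composition \<Rightarrow> 'k::comm_ring_1 series" where
  "calP q = dual (Qprime q)"


section \<open>Immaculate tableaux\<close>

text \<open>A filling is the list of its rows, row 1 first.\<close>

definition has_content :: "nat list list \<Rightarrow> composition \<Rightarrow> bool" where
  "has_content T \<beta> \<longleftrightarrow> (\<forall>i\<ge>1. count_list (concat T) i =
     (if i \<le> length (parts \<beta>) then parts \<beta> ! (i - 1) else 0))"

definition immaculate_tableau :: "composition \<Rightarrow> composition \<Rightarrow> nat list list \<Rightarrow> bool" where
  "immaculate_tableau \<alpha> \<beta> T \<longleftrightarrow>
     map length T = parts \<alpha> \<and> (\<forall>x\<in>set (concat T). 0 < x) \<and> has_content T \<beta> \<and>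
     (\<forall>r\<in>set T. sorted r) \<and> sorted_wrt (<) (map hd T)"

definition immaculate_tableaux :: "composition \<Rightarrow> nat list list set" where
  "immaculate_tableaux \<alpha> = {T. \<exists>\<beta>. immaculate_tableau \<alpha> \<beta> T}"

definition tab_content :: "nat list list \<Rightarrow> composition" where
  "tab_content T = (THE \<beta>. has_content T \<beta>)"

lemma tab_content_eq:
  assumes "has_content T \<beta>"
  shows "tab_content T = \<beta>"
  unfolding tab_content_def
proof (rule the_equality[of "has_content T", OF assms])
  fix \<gamma> assume \<gamma>: "has_content T \<gamma>"
  let ?part = "\<lambda>\<delta> j. if j < length (parts \<delta>) then parts \<delta> ! j else 0"
  have eq: "?part \<gamma> j = ?part \<beta> j" for j
  proof -
    have "?part \<delta> j = count_list (concat T) (Suc j)" if "has_content T \<delta>" for \<delta>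
      using that by (auto simp: has_content_def Suc_le_eq)
    with \<gamma> assms show ?thesis by metis
  qed
  have pos: "0 < parts \<delta> ! j" if "j < length (parts \<delta>)" for \<delta> j
    using that parts[of \<delta>] by auto
  have iff: "j < length (parts \<gamma>) \<longleftrightarrow> j < length (parts \<beta>)" for j
    using eq[of j] pos[of j \<gamma>] pos[of j \<beta>] by (auto split: if_splits)
  then have len: "length (parts \<gamma>) = length (parts \<beta>)"
    by (metis linorder_neqE_nat less_irrefl)
  have "parts \<gamma> = parts \<beta>"
    by (rule nth_equalityI[OF len]) (use eq len in metis)
  then show "\<gamma> = \<beta>" by (simp add: parts_inject)
qed

lemma finite_immaculate_tableaux: "finite (immaculate_tableaux \<alpha>)"
proof -
  define N where "N = sum_list (parts \<alpha>)"
  have sub: "length T \<le> N + length (parts \<alpha>) \<and> set T \<subseteq> {r. set r \<subseteq> {..N} \<and> length r \<le> N}"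
    if T: "immaculate_tableau \<alpha> \<beta> T" for \<beta> T
  proof -
    have shape: "map length T = parts \<alpha>" and pos: "\<forall>x\<in>set (concat T). 0 < x"
      and cont: "has_content T \<beta>"
      using T by (auto simp: immaculate_tableau_def)
    have N: "length (concat T) = N" by (simp add: length_concat shape N_def)
    have "{1..length (parts \<beta>)} \<subseteq> set (concat T)"
    proof
      fix i assume i: "i \<in> {1..length (parts \<beta>)}"
      then have "0 < parts \<beta> ! (i - 1)" using parts[of \<beta>] by auto
      then have "count_list (concat T) i \<noteq> 0" using cont i by (auto simp: has_content_def)
      then show "i \<in> set (concat T)" by (metis count_notin)
    qed
    then have "card {1..length (parts \<beta>)} \<le> card (set (concat T))"
      by (rule card_mono[rotated]) simp
    also have "\<dots> \<le> N" using card_length[of "concat T"] N by simp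
    finally have le: "length (parts \<beta>) \<le> N" by simp
    have "x \<le> N" if x: "x \<in> set (concat T)" for x
    proof -
      have "count_list (concat T) x \<noteq> 0" using x by (simp add: count_list_0_iff)
      moreover have "1 \<le> x" using pos x by (auto simp: Suc_le_eq)
      ultimately have "x \<le> length (parts \<beta>)" using cont by (auto simp: has_content_def split: if_splits)
      with le show ?thesis by simp
    qed
    moreover have "length r \<le> N" if "r \<in> set T" for r
      using that member_le_sum_list[of "length r" "map length T"] by (simp add: N_def flip: shape)
    moreover have "length T = length (parts \<alpha>)" using shape by (metis length_map)
    ultimately show ?thesis by auto
  qed
  have "immaculate_tableaux \<alpha> \<subseteq>
      {T. set T \<subseteq> {r. set r \<subseteq> {..N} \<and> length r \<le> N} \<and> length T \<le> N + length (parts \<alpha>)}"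
    using sub by (auto simp: immaculate_tableaux_def)
  then show ?thesis
    by (rule finite_subset) (intro finite_lists_length_le finite_atMost)
qed

definition nT :: "nat list list \<Rightarrow> nat" where
  "nT T = (\<Sum>r\<leftarrow>T. card (set r) - 1)"


section \<open>The field of rational functions and specialization\<close>

type_synonym ratfun = "rat poly fract"

definition qvar :: ratfun where
  "qvar = Fract [:0, 1:] 1"

text \<open>The rational function \<open>f\<close> is regular at \<open>c\<close> and has the value \<open>v\<close> there.\<close>

definition value_at :: "rat \<Rightarrow> ratfun \<Rightarrow> rat \<Rightarrow> bool" where
  "value_at c f v \<longleftrightarrow> (\<exists>a b. f = Fract a b \<and> poly b c \<noteq> 0 \<and> v = poly a c / poly b c)"

text \<open>At \<open>q = c\<close>, all coefficients of \<open>F\<close> specialize to those of \<open>G\<close>.\<close>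

definition specializes :: "rat \<Rightarrow> ratfun series \<Rightarrow> rat series \<Rightarrow> bool" where
  "specializes c F G \<longleftrightarrow> (\<forall>m. value_at c (scoeff F m) (scoeff G m))"

end

theory Submission
  imports Defs "HOL-Library.FuncSet" "HOL-Library.Multiset"
begin

text \<open>Skewing acts on complete functions by \<open>F\<^sup>\<bottom> H\<^sub>y = \<Sum>\<^sub>a\<^sub>+\<^sub>b\<^sub>=\<^sub>y [x\<^sup>a]F \<cdot> H\<^sub>b\<close>, where \<open>y\<close> is an exponent
  vector and \<open>H\<^sub>y\<close> is the product of the \<open>H\<close> indexed by its nonzero entries. Hence both creation
  operators are convolutions of \<open>H\<^sub>m\<^sub>+\<^sub>d\<close> with a series that is a product over the variables:
  \<open>E = \<Prod>(1 - x\<^sub>i)\<close> for the first, \<open>Q E\<close> with \<open>Q = \<Prod>1/(1 - q x\<^sub>i)\<close> for its deformation. The inverse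
  of \<open>Q E\<close> is \<open>W = \<Prod>(1 + (1 - q)(x\<^sub>i + x\<^sub>i\<^sup>2 + \<dots>))\<close>, whose coefficient at \<open>x\<^sup>c\<close> is \<open>1 - q\<close> to the
  number of variables in \<open>x\<^sup>c\<close>. The first row of an immaculate tableau contains all entries 1 together
  with some \<open>c\<close>, and contributes exactly this coefficient. So removing the first row convolves the
  tableau sum with \<open>W\<close>, and this cancels the \<open>Q E\<close> of the creation operator: pairing the deformed
  operator of index \<open>m\<close> applied to \<open>f\<close> with the tableau sum of shape \<open>(a, \<alpha>)\<close> gives the pairing
  of \<open>f\<close> with that of shape \<open>\<alpha>\<close> if \<open>m = a\<close>, and 0 otherwise. The same inverse expresses
  \<open>H\<^sub>y\<close> through the deformed basis, which gives uniqueness of the dual basis. Everything holds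
  for \<open>q\<close> in any commutative ring, and at \<open>q = 1\<close> and \<open>q = 0\<close> the deformed operators become
  multiplication by \<open>H\<^sub>m\<close> and the undeformed operators.\<close>

abbreviation lookup :: "('a \<Rightarrow>\<^sub>0 'b::zero) \<Rightarrow> 'a \<Rightarrow> 'b" where "lookup \<equiv> Poly_Mapping.lookup"
abbreviation keys :: "('a \<Rightarrow>\<^sub>0 'b::zero) \<Rightarrow> 'a set" where "keys \<equiv> Poly_Mapping.keys"
abbreviation single :: "'a \<Rightarrow> 'b::zero \<Rightarrow> 'a \<Rightarrow>\<^sub>0 'b" where "single \<equiv> Poly_Mapping.single"

section \<open>Exponent vectors\<close>

definition deg :: "(nat \<Rightarrow>\<^sub>0 nat) \<Rightarrow> nat" where
  "deg a = sum_list (exps a)"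

lemma deg_keys: "deg a = (\<Sum>x\<in>keys a. lookup a x)"
  unfolding deg_def exps_def
  by (subst sum_list_distinct_conv_sum_set) auto

lemma deg_superset: "finite A \<Longrightarrow> keys a \<subseteq> A \<Longrightarrow> deg a = (\<Sum>x\<in>A. lookup a x)"
  unfolding deg_keys by (rule sum.mono_neutral_left) (auto simp: in_keys_iff)

lemma keys_add_nat: "keys (a + b) = keys a \<union> keys (b :: 'a \<Rightarrow>\<^sub>0 nat)"
  by (auto simp: in_keys_iff lookup_add)

lemma deg_add: "deg (a + b) = deg a + deg b"
proof -
  have "deg (a + b) = (\<Sum>x\<in>keys a \<union> keys b. lookup a x + lookup b x)"
    by (subst deg_superset[of "keys a \<union> keys b"]) (auto simp: keys_add_nat lookup_add)
  then show ?thesis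
    by (simp add: sum.distrib deg_superset[of "keys a \<union> keys b"])
qed

text \<open>A sorted list without repetitions is determined by its set, so any such list of
  variables that contains the support will do; the extra variables only produce zeros.\<close>

lemma exps_filter:
  assumes "sorted ks" "distinct ks" "keys a \<subseteq> set ks"
  shows "exps a = filter ((\<noteq>) 0) (map (lookup a) ks)"
proof -
  have "sorted_list_of_set (keys a) = filter (\<lambda>x. x \<in> keys a) ks"
    using assms by (intro sorted_distinct_set_unique) (auto intro: sorted_wrt_filter)
  moreover have "filter (\<lambda>x. x \<in> keys a) ks = filter ((\<noteq>) 0 \<circ> lookup a) ks"
    by (rule filter_cong) (auto simp: in_keys_iff)
  ultimately show ?thesis
    by (simp add: exps_def filter_map)
qed

lemma exps_pos: "x \<in> set (exps m) \<Longrightarrow> 0 < x"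
  by (auto simp: exps_def in_keys_iff)

definition comp_of :: "(nat \<Rightarrow>\<^sub>0 nat) \<Rightarrow> composition" where
  "comp_of y = Composition (exps y)"

lemma parts_comp_of [simp]: "parts (comp_of y) = exps y"
  unfolding comp_of_def by (rule Composition_inverse) (auto simp: exps_pos)

lemma exps_nth_exps [simp]: "exps (Poly_Mapping.nth (exps m)) = exps m"
  using exps_nth[of "comp_of m"] by simp

lemma comp_of_in_comps: "comp_of y \<in> comps n \<longleftrightarrow> deg y = n"
  by (simp add: comps_def deg_def)

text \<open>Zeros are allowed in \<open>u\<close> and \<open>v\<close>: these are the splittings of
  a monomial, recorded along its support, so that they depend on the exponent list alone.\<close>

definition lsplits :: "nat list \<Rightarrow> (nat list \<times> nat list) set" where
  "lsplits es = {(u, v). length u = length es \<and> length v = length es \<and> map2 (+) u v = es}"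

lemma splits_keys: "(a, b) \<in> splits m \<Longrightarrow> keys a \<subseteq> keys m \<and> keys b \<subseteq> keys m"
  by (auto simp: splits_def keys_add_nat)

text \<open>Both factors of a monomial are supported inside it, so listing their exponents along its
  support is a bijection from \<open>splits\<close> to \<open>lsplits\<close>. The right side sees
  \<open>m\<close> only through \<open>exps m\<close>, which is how quasisymmetry is proved
  below.\<close>

lemma sum_splits_exps:
  "(\<Sum>(a, b)\<in>splits m. f (exps a) * g (exps b)) =
   (\<Sum>(u, v)\<in>lsplits (exps m). f (filter ((\<noteq>) 0) u) * g (filter ((\<noteq>) 0) v))"
proof -
  define ks where "ks = sorted_list_of_set (keys m)"
  have ks: "sorted ks" "distinct ks" "set ks = keys m" by (simp_all add: ks_def)
  have em: "exps m = map (lookup m) ks" by (simp add: exps_def ks_def)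
  define h where "h = (\<lambda>(a :: nat \<Rightarrow>\<^sub>0 nat, b :: nat \<Rightarrow>\<^sub>0 nat). (map (lookup a) ks, map (lookup b) ks))"
  have bij: "bij_betw h (splits m) (lsplits (exps m))"
  proof (rule bij_betw_imageI)
    have eqI: "a = a'" if "keys a \<subseteq> keys m" "keys a' \<subseteq> keys m" "map (lookup a) ks = map (lookup a') ks"
      for a a' :: "nat \<Rightarrow>\<^sub>0 nat"
    proof (rule poly_mapping_eqI)
      fix x
      show "lookup a x = lookup a' x"
      proof (cases "x \<in> keys m")
        case True
        then show ?thesis using that(3) ks(3) by (metis map_eq_conv)
      next
        case False
        then have "x \<notin> keys a" "x \<notin> keys a'" using that by auto
        then show ?thesis by (simp add: in_keys_iff)
      qed
    qed
    show "inj_on h (splits m)"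
      by (auto simp: inj_on_def h_def intro!: eqI dest!: splits_keys)
    show "h ` splits m = lsplits (exps m)"
    proof (intro subset_antisym subsetI)
      fix p assume "p \<in> h ` splits m"
      then show "p \<in> lsplits (exps m)"
        by (auto simp: h_def lsplits_def em splits_def lookup_add intro!: nth_equalityI)
    next
      fix p assume p: "p \<in> lsplits (exps m)"
      obtain u v where uv: "p = (u, v)" by (cases p)
      have len: "length u = length ks" "length v = length ks" and m2: "map2 (+) u v = map (lookup m) ks"
        using p by (auto simp: uv lsplits_def em)
      \<comment> \<open>Inverse of \<open>h\<close>: a list entry becomes the exponent of the
        variable at the same position of the support.\<close>
      define vec :: "nat list \<Rightarrow> nat \<Rightarrow>\<^sub>0 nat" where "vec w = (\<Sum>i<length ks. single (ks ! i) (w ! i))" for w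
      have vec_nth: "lookup (vec w) (ks ! j) = w ! j" if "j < length ks" for w j
      proof -
        have "lookup (vec w) (ks ! j) = (\<Sum>i<length ks. if i = j then w ! i else 0)"
          unfolding vec_def lookup_sum
          by (rule sum.cong) (use ks that in \<open>auto simp: lookup_single when_def nth_eq_iff_index_eq\<close>)
        then show ?thesis using that by simp
      qed
      have vec_out: "lookup (vec w) x = 0" if "x \<notin> keys m" for w x
      proof -
        have "ks ! i \<noteq> x" if "i < length ks" for i using that \<open>x \<notin> keys m\<close> ks(3) nth_mem by blast
        then show ?thesis by (simp add: vec_def lookup_sum lookup_single when_def)
      qed
      have "vec u + vec v = m"
      proof (rule poly_mapping_eqI)
        fix x
        show "lookup (vec u + vec v) x = lookup m x"
        proof (cases "x \<in> keys m")
          case True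
          then obtain j where j: "j < length ks" "x = ks ! j" using ks(3) by (metis in_set_conv_nth)
          have "map2 (+) u v ! j = map (lookup m) ks ! j" by (simp add: m2)
          then show ?thesis using j len by (simp add: lookup_add vec_nth)
        qed (simp add: lookup_add vec_out in_keys_iff)
      qed
      moreover have "h (vec u, vec v) = p"
        by (auto simp: h_def uv vec_nth len intro!: nth_equalityI)
      ultimately show "p \<in> h ` splits m" by (force simp: splits_def)
    qed
  qed
  have "(\<Sum>(a, b)\<in>splits m. f (exps a) * g (exps b)) =
      (\<Sum>p\<in>splits m. case h p of (u, v) \<Rightarrow> f (filter ((\<noteq>) 0) u) * g (filter ((\<noteq>) 0) v))"
    by (rule sum.cong) (use ks in \<open>auto simp: h_def exps_filter dest!: splits_keys\<close>)
  also have "\<dots> = (\<Sum>(u, v)\<in>lsplits (exps m). f (filter ((\<noteq>) 0) u) * g (filter ((\<noteq>) 0) v))"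
    by (rule sum.reindex_bij_betw[OF bij])
  finally show ?thesis .
qed

section \<open>Quasisymmetric series and their products\<close>

definition quasi :: "'k::comm_ring_1 series \<Rightarrow> bool" where
  "quasi F \<longleftrightarrow> (\<forall>m m'. exps m = exps m' \<longrightarrow> scoeff F m = scoeff F m')"

lemma quasi_nth: "quasi F \<Longrightarrow> scoeff F m = scoeff F (Poly_Mapping.nth (exps m))"
  unfolding quasi_def by (metis exps_nth_exps)

lemma quasi_mult:
  assumes "quasi F" "quasi G"
  shows "quasi (F * G)"
proof -
  let ?f = "\<lambda>es. scoeff F (Poly_Mapping.nth es)" and ?g = "\<lambda>es. scoeff G (Poly_Mapping.nth es)"
  have "scoeff (F * G) m = (\<Sum>(u, v)\<in>lsplits (exps m). ?f (filter ((\<noteq>) 0) u) * ?g (filter ((\<noteq>) 0) v))" for m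
  proof -
    have "scoeff (F * G) m = (\<Sum>(a, b)\<in>splits m. ?f (exps a) * ?g (exps b))"
      unfolding times_series.rep_eq
      by (rule sum.cong) (auto simp flip: quasi_nth[OF assms(1)] quasi_nth[OF assms(2)])
    also have "\<dots> = (\<Sum>(u, v)\<in>lsplits (exps m). ?f (filter ((\<noteq>) 0) u) * ?g (filter ((\<noteq>) 0) v))"
      by (rule sum_splits_exps)
    finally show ?thesis .
  qed
  then show ?thesis unfolding quasi_def by metis
qed

lemma QSym_iff: "F \<in> QSym \<longleftrightarrow> quasi F \<and> (\<exists>d. \<forall>m. scoeff F m \<noteq> 0 \<longrightarrow> deg m \<le> d)"
  unfolding QSym_def quasi_def deg_def by blast

lemma QSym_mult:
  assumes "F \<in> QSym" "G \<in> QSym"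
  shows "F * G \<in> QSym"
proof -
  from assms obtain d e where d: "\<And>m. scoeff F m \<noteq> 0 \<Longrightarrow> deg m \<le> d" and e: "\<And>m. scoeff G m \<noteq> 0 \<Longrightarrow> deg m \<le> e"
    by (auto simp: QSym_iff)
  have "deg m \<le> d + e" if "scoeff (F * G) m \<noteq> 0" for m
  proof -
    have "\<exists>p\<in>splits m. (case p of (a, b) \<Rightarrow> scoeff F a * scoeff G b) \<noteq> 0"
      using that unfolding times_series.rep_eq by (meson sum.not_neutral_contains_not_neutral)
    then obtain a b where ab: "(a, b) \<in> splits m" "scoeff F a * scoeff G b \<noteq> 0" by auto
    then have "scoeff F a \<noteq> 0" "scoeff G b \<noteq> 0" by auto
    then show ?thesis using d[of a] e[of b] ab(1) by (auto simp: splits_def deg_add)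
  qed
  then show ?thesis using assms by (auto simp: QSym_iff quasi_mult)
qed

lemma M_QSym: "(M \<beta> :: 'a::comm_ring_1 series) \<in> QSym"
proof -
  have "deg m \<le> sum_list (parts \<beta>)" if "scoeff (M \<beta> :: 'a series) m \<noteq> 0" for m
    using that by (simp add: M.rep_eq deg_def split: if_splits)
  then show ?thesis unfolding QSym_iff quasi_def by (intro conjI exI allI impI) (auto simp: M.rep_eq)
qed

lemma scoeff_sum: "scoeff (\<Sum>x\<in>A. f x) m = (\<Sum>x\<in>A. scoeff (f x) m)"
  by (induction A rule: infinite_finite_induct) (simp_all add: zero_series.rep_eq plus_series.rep_eq)

text \<open>A monomial occurs in exactly one \<open>M \<gamma>\<close>, the one indexed by its own
  exponents. So \<open>Fq i\<close> is the complete homogeneous symmetric function.\<close>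

lemma scoeff_Fq: "scoeff (Fq i) m = (if deg m = i then 1 else 0 :: 'k::comm_ring_1)"
proof -
  have "scoeff (Fq i :: 'k series) m = (\<Sum>\<gamma>\<in>comps i. if \<gamma> = comp_of m then 1 else 0)"
    unfolding Fq_def scoeff_sum M.rep_eq
    by (rule sum.cong) (auto simp: parts_inject simp flip: parts_comp_of)
  then show ?thesis by (simp add: finite_comps comp_of_in_comps)
qed

lemma Fq_QSym: "(Fq i :: 'a::comm_ring_1 series) \<in> QSym"
proof -
  have "deg m \<le> i" if "scoeff (Fq i :: 'a series) m \<noteq> 0" for m
    using that by (simp add: scoeff_Fq split: if_splits)
  then show ?thesis unfolding QSym_iff quasi_def by (auto simp: scoeff_Fq deg_def)
qed

section \<open>Linear algebra in NSym\<close>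

text \<open>The indexing is redundant, since only \<open>exps y\<close> matters, but it lets skewing
  be written as a sum over the splittings of a monomial.\<close>

definition hm :: "(nat \<Rightarrow>\<^sub>0 nat) \<Rightarrow> 'k::comm_ring_1 nsym" where
  "hm y = single (comp_of y) 1"

lemma nconst_0 [simp]: "nconst 0 = 0"
  and nconst_1 [simp]: "nconst 1 = 1"
  and nconst_add: "nconst (c + d) = nconst c + nconst d"
  and nconst_mult: "nconst (c * d) = nconst c * nconst d"
  by (simp_all add: nconst_def single_add mult_single)

lemma nconst_minus: "nconst (- c) = - nconst (c :: 'k::ring_1)"
  by (simp add: nconst_def single_uminus)

lemma nconst_mult_single: "nconst c * single \<beta> d = single \<beta> (c * d)"
  by (simp add: nconst_def mult_single)

lemma poly_mapping_sum_monomials: "(\<Sum>x\<in>keys f. single x (lookup f x)) = f"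
proof (rule poly_mapping_eqI)
  fix y
  show "lookup (\<Sum>x\<in>keys f. single x (lookup f x)) y = lookup f y"
    by (cases "y \<in> keys f") (simp_all add: lookup_sum lookup_single when_def in_keys_iff)
qed

lemma nconst_central: "f * nconst c = nconst c * (f :: 'k::comm_ring_1 nsym)"
proof -
  have "(\<Sum>x\<in>keys f. single x (lookup f x)) * nconst c = nconst c * (\<Sum>x\<in>keys f. single x (lookup f x))"
    by (simp add: sum_distrib_right sum_distrib_left nconst_def mult_single mult.commute)
  then show ?thesis by (simp only: poly_mapping_sum_monomials)
qed

text \<open>A representative of \<open>\<beta>\<close> that leaves variable 0 free, so that a
  creation operator can put its new part there. It also matches tableau entries, which start at
  1.\<close>

definition shifted :: "composition \<Rightarrow> nat \<Rightarrow>\<^sub>0 nat" where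
  "shifted \<beta> = Poly_Mapping.nth (0 # parts \<beta>)"

lemma lookup_shifted: "lookup (shifted \<beta>) i = (if i = 0 \<or> length (parts \<beta>) < i then 0 else parts \<beta> ! (i - 1))"
  by (cases i) (auto simp: shifted_def nth.rep_eq nth_default_def)

lemma keys_shifted: "keys (shifted \<beta>) = {1..length (parts \<beta>)}"
proof -
  have "0 < parts \<beta> ! (i - 1)" if "i \<noteq> 0" "i \<le> length (parts \<beta>)" for i
    using that parts[of \<beta>] by auto
  then show ?thesis by (auto simp: in_keys_iff lookup_shifted split: if_splits)
qed

lemma zero_notin_shifted: "0 \<notin> keys (shifted \<beta>)"
  by (simp add: keys_shifted)

lemma exps_shifted [simp]: "exps (shifted \<beta>) = parts \<beta>"
proof -
  have "exps (shifted \<beta>) = filter ((\<noteq>) 0) (map (lookup (shifted \<beta>)) [0..<Suc (length (parts \<beta>))])"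
    by (rule exps_filter) (auto simp: keys_shifted simp del: upt_Suc)
  also have "map (lookup (shifted \<beta>)) [0..<Suc (length (parts \<beta>))] = 0 # parts \<beta>"
    by (rule nth_equalityI) (auto simp: lookup_shifted nth_Cons' simp del: upt_Suc)
  also have "filter ((\<noteq>) 0) (0 # parts \<beta>) = parts \<beta>"
    using parts[of \<beta>] by (auto simp: filter_id_conv)
  finally show ?thesis .
qed

lemma comp_of_shifted [simp]: "comp_of (shifted \<beta>) = \<beta>"
  by (simp add: comp_of_def parts_inverse)

text \<open>Every generator has a \<open>shifted\<close> representative, so the generator case may
  assume that variable 0 is free for a part to be prepended.\<close>

lemma nsym_induct [case_names zero add hm]:
  assumes "P 0" "\<And>f g. P f \<Longrightarrow> P g \<Longrightarrow> P (f + g)"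
    and hm: "\<And>c y. 0 \<notin> keys y \<Longrightarrow> P (nconst c * hm y)"
  shows "P (f :: 'k::comm_ring_1 nsym)"
proof -
  have "P (single \<beta> c)" for \<beta> c
    using hm[OF zero_notin_shifted, of c \<beta>] by (simp add: hm_def nconst_mult_single)
  then have "P (\<Sum>x\<in>A. single x (lookup f x))" for A
    by (induction A rule: infinite_finite_induct) (auto intro: assms)
  from this[of "keys f"] show ?thesis by (simp add: poly_mapping_sum_monomials)
qed

section \<open>The pairing and linear maps\<close>

lemma pairing_superset:
  "finite A \<Longrightarrow> keys h \<subseteq> A \<Longrightarrow>
    pairing h F = (\<Sum>\<alpha>\<in>A. lookup h \<alpha> * scoeff F (Poly_Mapping.nth (parts \<alpha>)))"
  unfolding pairing_def by (rule sum.mono_neutral_left) (auto simp: in_keys_iff)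

lemma pairing_add: "pairing (f + g) F = pairing f F + pairing g F"
  by (simp add: pairing_superset[of "keys f \<union> keys g"] Poly_Mapping.keys_add lookup_add
      distrib_right sum.distrib)

lemma pairing_0 [simp]: "pairing 0 F = 0"
  by (simp add: pairing_def)

lemma pairing_sum: "pairing (\<Sum>x\<in>A. f x) F = (\<Sum>x\<in>A. pairing (f x) F)"
  by (induction A rule: infinite_finite_induct) (simp_all add: pairing_add)

lemma pairing_single: "pairing (single \<beta> c) F = c * scoeff F (Poly_Mapping.nth (parts \<beta>))"
  by (simp add: pairing_superset[of "{\<beta>}"])

lemma pairing_nconst_hm: "quasi F \<Longrightarrow> pairing (nconst c * hm y) F = c * scoeff F y"
  by (simp add: hm_def nconst_mult_single pairing_single flip: quasi_nth)

lemma pairing_hm: "quasi F \<Longrightarrow> pairing (hm y) F = scoeff F y"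
  using pairing_nconst_hm[of F 1 y] by simp

lemma pairing_nconst: "pairing (nconst c * f) F = c * pairing f F"
proof -
  have "pairing (nconst c * single \<beta> d) F = c * pairing (single \<beta> d) F" for \<beta> d
    by (simp add: nconst_mult_single pairing_single)
  then have "pairing (nconst c * (\<Sum>x\<in>keys f. single x (lookup f x))) F
      = c * pairing (\<Sum>x\<in>keys f. single x (lookup f x)) F"
    by (simp add: sum_distrib_left pairing_sum)
  then show ?thesis by (simp only: poly_mapping_sum_monomials)
qed

lemma pairing_M: "pairing f (M \<beta>) = lookup f \<beta>"
proof -
  have "pairing f (M \<beta>) = (\<Sum>\<alpha>\<in>insert \<beta> (keys f). lookup f \<alpha> * (if \<alpha> = \<beta> then 1 else 0))"
    by (subst pairing_superset[of "insert \<beta> (keys f)"]) (auto simp: M.rep_eq exps_nth parts_inject)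
  then show ?thesis by (simp add: if_distrib cong: if_cong)
qed

text \<open>The \<open>M \<beta>\<close> already detect all coefficients. This makes adjoints
  unique.\<close>

lemma nsym_eqI:
  assumes "\<And>G. G \<in> QSym \<Longrightarrow> pairing f G = pairing g G"
  shows "f = g"
proof (rule poly_mapping_eqI)
  fix \<beta>
  show "lookup f \<beta> = lookup g \<beta>" using assms[OF M_QSym[of \<beta>]] by (simp add: pairing_M)
qed

definition nlinear :: "('k::comm_ring_1 nsym \<Rightarrow> 'k nsym) \<Rightarrow> bool" where
  "nlinear \<phi> \<longleftrightarrow> (\<forall>f g. \<phi> (f + g) = \<phi> f + \<phi> g) \<and> (\<forall>c f. \<phi> (nconst c * f) = nconst c * \<phi> f)"

lemma nlinear_add: "nlinear \<phi> \<Longrightarrow> \<phi> (f + g) = \<phi> f + \<phi> g"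
  and nlinear_nconst: "nlinear \<phi> \<Longrightarrow> \<phi> (nconst c * f) = nconst c * \<phi> f"
  by (simp_all add: nlinear_def)

lemma nlinear_0: "nlinear \<phi> \<Longrightarrow> \<phi> 0 = 0"
  using nlinear_nconst[of \<phi> 0 0] by simp

lemma nlinear_sum: "nlinear \<phi> \<Longrightarrow> \<phi> (\<Sum>x\<in>A. f x) = (\<Sum>x\<in>A. \<phi> (f x))"
  by (induction A rule: infinite_finite_induct) (simp_all add: nlinear_0 nlinear_add)

section \<open>Skewing\<close>

lemma perp_eqI:
  assumes "\<And>G. G \<in> QSym \<Longrightarrow> pairing g G = pairing h (F * G)"
  shows "perp F h = g"
  unfolding perp_def
  by (rule the_equality) (use assms in \<open>auto intro!: nsym_eqI\<close>)

text \<open>Pairing with \<open>hm y\<close> reads off the coefficient at \<open>y\<close>, which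
  for a product is the Cauchy sum over the splittings of \<open>y\<close>.\<close>

lemma perp_hm_pairing:
  assumes "F \<in> QSym" "G \<in> QSym"
  shows "pairing (\<Sum>(a, b)\<in>splits y. nconst (scoeff F a) * hm b) G = pairing (hm y) (F * G)"
  using assms QSym_mult[OF assms]
  by (simp add: QSym_iff pairing_sum pairing_hm pairing_nconst_hm times_series.rep_eq case_prod_unfold)

lemma perp_hm:
  "F \<in> QSym \<Longrightarrow> perp F (hm y) = (\<Sum>(a, b)\<in>splits y. nconst (scoeff F a) * hm b)"
  by (rule perp_eqI) (rule perp_hm_pairing)

text \<open>The \<open>THE\<close> in \<open>perp\<close> needs an adjoint to exist: it is explicit
  on generators and extends by linearity.\<close>

lemma pairing_perp:
  assumes F: "F \<in> QSym" and G: "G \<in> QSym"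
  shows "pairing (perp F h) G = pairing h (F * G)"
proof -
  have "\<exists>g. \<forall>G\<in>QSym. pairing g G = pairing h (F * G)"
  proof (induction h rule: nsym_induct)
    case zero
    show ?case by (rule exI[of _ 0]) simp
  next
    case (add f g)
    then show ?case by (metis pairing_add)
  next
    case (hm c y)
    show ?case using perp_hm_pairing[OF F] by (metis pairing_nconst)
  qed
  then obtain g where g: "\<And>G. G \<in> QSym \<Longrightarrow> pairing g G = pairing h (F * G)" by blast
  with perp_eqI[of g h F] G show ?thesis by simp
qed

lemma perp_nlinear: "F \<in> QSym \<Longrightarrow> nlinear (perp F)"
  unfolding nlinear_def
  by (intro conjI allI perp_eqI) (simp_all add: pairing_add pairing_nconst pairing_perp)

text \<open>The creation operators have the shape \<open>\<Sum>\<^sub>i K\<^sub>i \<circ> F\<^sub>i\<^sup>\<bottom>\<close> with \<open>F\<^sub>i\<close> homogeneous of degree \<open>i\<close>.\<close>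

locale graded_family =
  fixes FF :: "nat \<Rightarrow> 'k::comm_ring_1 series" and K :: "nat \<Rightarrow> 'k nsym \<Rightarrow> 'k nsym"
  assumes FF: "FF i \<in> QSym" and graded: "scoeff (FF i) a \<noteq> 0 \<Longrightarrow> deg a = i"
    and K: "nlinear (K i)"
begin

definition creation :: "'k nsym \<Rightarrow> 'k nsym" where
  "creation f = Sum_any (\<lambda>i. K i (perp (FF i) f))"

text \<open>On \<open>hm y\<close> only the degrees of divisors of the monomial \<open>y\<close>
  occur, so \<open>Sum_any\<close> really sums the operator series.\<close>

lemma finite_perp: "finite {i. perp (FF i) f \<noteq> 0}"
proof (induction f rule: nsym_induct)
  case zero
  show ?case using perp_nlinear[OF FF] by (simp add: nlinear_0)
next
  case (add f g)
  have "{i. perp (FF i) (f + g) \<noteq> 0} \<subseteq> {i. perp (FF i) f \<noteq> 0} \<union> {i. perp (FF i) g \<noteq> 0}"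
    using perp_nlinear[OF FF] by (auto simp: nlinear_add)
  then show ?case using add by (meson finite_UnI finite_subset)
next
  case (hm c y)
  have "{i. perp (FF i) (nconst c * hm y) \<noteq> 0} \<subseteq> (deg \<circ> fst) ` splits y"
  proof clarify
    fix i assume i: "perp (FF i) (nconst c * hm y) \<noteq> 0"
    have "perp (FF i) (nconst c * hm y) = nconst c * perp (FF i) (hm y)"
      using perp_nlinear[OF FF] by (simp add: nlinear_nconst)
    with i have "perp (FF i) (hm y) \<noteq> 0" by auto
    then have "\<exists>p\<in>splits y. (case p of (a, b) \<Rightarrow> nconst (scoeff (FF i) a) * (hm b :: 'k nsym)) \<noteq> 0"
      unfolding perp_hm[OF FF] by (meson sum.not_neutral_contains_not_neutral)
    then obtain a b where "(a, b) \<in> splits y" "scoeff (FF i) a \<noteq> 0" by fastforce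
    then show "i \<in> (deg \<circ> fst) ` splits y" using graded by force
  qed
  then show ?case using finite_splits by (meson finite_imageI finite_subset)
qed

lemma finite_K_perp: "finite {i. K i (perp (FF i) f) \<noteq> 0}"
  by (rule finite_subset[OF _ finite_perp[of f]]) (auto simp: nlinear_0[OF K])

lemma creation_nlinear: "nlinear creation"
  unfolding nlinear_def creation_def
  by (simp add: nlinear_add[OF perp_nlinear[OF FF]] nlinear_nconst[OF perp_nlinear[OF FF]]
      nlinear_add[OF K] nlinear_nconst[OF K] Sum_any.distrib[OF finite_K_perp finite_K_perp]
      Sum_any_right_distrib[OF finite_K_perp])

text \<open>By homogeneity a splitting \<open>(a, b)\<close> contributes only to the summand of
  index \<open>deg a\<close>; after exchanging the two sums, the one over indices collapses.\<close>

lemma creation_hm: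
  "creation (hm y) = (\<Sum>(a, b)\<in>splits y. nconst (scoeff (FF (deg a)) a) * K (deg a) (hm b))"
proof -
  define I where "I = (deg \<circ> fst) ` splits y"
  let ?t = "\<lambda>i. \<lambda>(a, b). nconst (scoeff (FF i) a) * K i (hm b)"
  have eq: "K i (perp (FF i) (hm y)) = (\<Sum>p\<in>splits y. ?t i p)" for i
    by (simp add: perp_hm[OF FF] nlinear_sum[OF K] nlinear_nconst[OF K] case_prod_unfold)
  have I: "finite I" by (simp add: I_def finite_splits)
  have vanish: "?t i (a, b) = 0" if "i \<noteq> deg a" for i a b
    using that graded[of i a] by (cases "scoeff (FF i) a = 0") auto
  have "creation (hm y) = (\<Sum>i\<in>I. \<Sum>p\<in>splits y. ?t i p)"
    unfolding creation_def eq
  proof (rule Sum_any.expand_superset[OF I], clarify)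
    fix i assume "(\<Sum>p\<in>splits y. ?t i p) \<noteq> 0"
    then obtain p where p: "p \<in> splits y" "?t i p \<noteq> 0" by (meson sum.not_neutral_contains_not_neutral)
    then have "i = deg (fst p)" using vanish[of i "fst p" "snd p"] by (cases p) auto
    with p(1) show "i \<in> I" by (simp add: I_def)
  qed
  also have "\<dots> = (\<Sum>p\<in>splits y. \<Sum>i\<in>I. ?t i p)" by (rule sum.swap)
  also have "\<dots> = (\<Sum>p\<in>splits y. ?t (deg (fst p)) p)"
  proof (rule sum.cong[OF refl])
    fix p assume p: "p \<in> splits y"
    have "(\<Sum>i\<in>I. ?t i p) = (\<Sum>i\<in>{deg (fst p)}. ?t i p)"
      by (rule sum.mono_neutral_right[OF I]) (use p vanish[of _ "fst p" "snd p"] in \<open>auto simp: I_def case_prod_unfold\<close>)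
    then show "(\<Sum>i\<in>I. ?t i p) = ?t (deg (fst p)) p" by simp
  qed
  finally show ?thesis by (simp add: case_prod_unfold)
qed

end

section \<open>Convolution with multiplicative series\<close>

text \<open>Both scalar-valued functionals and \<open>NSym\<close>-valued operators are convolved; \<open>s\<close> is the
  scalar multiplication.\<close>

definition conv :: "('k::comm_ring_1 \<Rightarrow> 'r::comm_monoid_add \<Rightarrow> 'r) \<Rightarrow> 'k series \<Rightarrow>
    (nat \<Rightarrow> (nat \<Rightarrow>\<^sub>0 nat) \<Rightarrow> 'r) \<Rightarrow> (nat \<Rightarrow>\<^sub>0 nat) \<Rightarrow> 'r" where
  "conv s F X y = (\<Sum>(a, b)\<in>splits y. s (scoeff F a) (X (deg a) b))"

lemma conv_cong:
  "(\<And>a b. (a, b) \<in> splits y \<Longrightarrow> X (deg a) b = X' (deg a) b) \<Longrightarrow> conv s F X y = conv s F X' y"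
  unfolding conv_def by (rule sum.cong) auto

text \<open>\<open>X\<close> sees only the total degree removed and the vector that remains. So both
  sides sum over threefold splittings, bracketed in two ways.\<close>

lemma conv_conv:
  fixes s :: "'k::comm_ring_1 \<Rightarrow> 'r::ab_group_add \<Rightarrow> 'r"
  assumes s: "module s"
  shows "conv s F (\<lambda>d. conv s G (\<lambda>e. X (d + e))) y = conv s (F * G) X y"
proof -
  interpret module s by (rule s)
  have "conv s F (\<lambda>d. conv s G (\<lambda>e. X (d + e))) y
      = (\<Sum>(a, p)\<in>splits y. \<Sum>(b, c)\<in>splits p. s (scoeff F a * scoeff G b) (X (deg (a + b)) c))"
    by (simp add: conv_def case_prod_unfold scale_sum_right deg_add)
  also have "\<dots> = (\<Sum>((a, p), (b, c))\<in>Sigma (splits y) (\<lambda>(a, p). splits p).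
      s (scoeff F a * scoeff G b) (X (deg (a + b)) c))"
    by (subst sum.Sigma[symmetric]) (auto simp: finite_splits case_prod_unfold)
  also have "\<dots> = (\<Sum>((p, c), (a, b))\<in>Sigma (splits y) (\<lambda>(p, c). splits p).
      s (scoeff F a * scoeff G b) (X (deg p) c))"
    by (rule sum.reindex_bij_witness
        [where j = "\<lambda>((a, p), (b, c)). ((a + b, c), (a, b))"
           and i = "\<lambda>((p, c), (a, b)). ((a, b + c), (b, c))"])
      (auto simp: splits_def ac_simps)
  also have "\<dots> = (\<Sum>(p, c)\<in>splits y. \<Sum>(a, b)\<in>splits p. s (scoeff F a * scoeff G b) (X (deg p) c))"
    by (subst sum.Sigma[symmetric]) (auto simp: finite_splits case_prod_unfold)
  also have "\<dots> = conv s (F * G) X y"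
    by (simp add: conv_def times_series.rep_eq case_prod_unfold scale_sum_left)
  finally show ?thesis .
qed

lemma deg_0 [simp]: "deg 0 = 0"
  by (simp add: deg_keys)

lemma conv_1:
  fixes s :: "'k::comm_ring_1 \<Rightarrow> 'r::ab_group_add \<Rightarrow> 'r"
  assumes s: "module s"
  shows "conv s 1 X y = X 0 y"
proof -
  interpret module s by (rule s)
  have "conv s 1 X y = (\<Sum>(a, b)\<in>{(0 :: nat \<Rightarrow>\<^sub>0 nat, y)}. s (scoeff 1 a) (X (deg a) b))"
    unfolding conv_def
    by (rule sum.mono_neutral_right[OF finite_splits])
      (auto simp: splits_def one_series.rep_eq split: if_splits)
  then show ?thesis by (simp add: one_series.rep_eq)
qed

definition nscale :: "'k::comm_ring_1 \<Rightarrow> 'k nsym \<Rightarrow> 'k nsym" where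
  "nscale c f = nconst c * f"

lemma module_nscale: "module nscale"
  by standard (simp_all add: nscale_def distrib_left distrib_right nconst_add nconst_mult mult.assoc)

lemma module_times: "module ((*) :: 'k::comm_ring_1 \<Rightarrow> 'k \<Rightarrow> 'k)"
  by standard (simp_all add: algebra_simps)

text \<open>For \<open>f 0 = 1\<close> this is the infinite product, over all variables, of the
  one-variable series with coefficients \<open>f\<close>: variables outside the monomial contribute
  1.\<close>

lift_definition pser :: "(nat \<Rightarrow> 'k) \<Rightarrow> 'k::comm_ring_1 series"
  is "\<lambda>f m. \<Prod>x\<in>keys m. f (lookup m x)" .

lemma pser_superset:
  "f 0 = 1 \<Longrightarrow> finite A \<Longrightarrow> keys m \<subseteq> A \<Longrightarrow> scoeff (pser f) m = (\<Prod>x\<in>A. f (lookup m x))"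
  unfolding pser.rep_eq by (rule prod.mono_neutral_left) (auto simp: in_keys_iff)

text \<open>Choosing a summand of the one-variable convolution for each variable of \<open>m\<close>
  amounts to choosing a splitting of \<open>m\<close>.\<close>

lemma pser_mult:
  assumes f: "f 0 = 1" and g: "g 0 = 1"
  shows "pser f * pser g = pser (\<lambda>n. \<Sum>i\<le>n. f i * g (n - i))"
proof (rule series_eqI)
  fix m :: "nat \<Rightarrow>\<^sub>0 nat"
  define S where "S = keys m"
  have S: "finite S" by (simp add: S_def)
  define vec :: "(nat \<Rightarrow> nat) \<Rightarrow> nat \<Rightarrow>\<^sub>0 nat" where "vec h = (\<Sum>x\<in>S. single x (h x))" for h
  have vec: "lookup (vec h) x = (if x \<in> S then h x else 0)" for h x
    using S by (simp add: vec_def lookup_sum lookup_single when_def)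
  have "scoeff (pser (\<lambda>n. \<Sum>i\<le>n. f i * g (n - i))) m
      = (\<Sum>h\<in>PiE S (\<lambda>x. {..lookup m x}). \<Prod>x\<in>S. f (h x) * g (lookup m x - h x))"
    unfolding pser.rep_eq S_def by (rule prod_sum_PiE) simp_all
  also have "\<dots> = (\<Sum>(a, b)\<in>splits m. (\<Prod>x\<in>S. f (lookup a x)) * (\<Prod>x\<in>S. g (lookup b x)))"
  proof (rule sum.reindex_bij_witness[where i = "\<lambda>(a, b). restrict (lookup a) S"
        and j = "\<lambda>h. (vec h, m - vec h)"])
    fix h assume h: "h \<in> (\<Pi>\<^sub>E x\<in>S. {..lookup m x})"
    then have le: "h x \<le> lookup m x" if "x \<in> S" for x using that by auto
    show "(case (vec h, m - vec h) of (a, b) \<Rightarrow> restrict (lookup a) S) = h"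
      using h by (auto simp: vec fun_eq_iff PiE_def extensional_def)
    have "lookup (vec h + (m - vec h)) x = lookup m x" for x
      using le[of x] by (simp add: lookup_add lookup_minus vec)
    then show "(vec h, m - vec h) \<in> splits m"
      by (auto simp: splits_def intro: poly_mapping_eqI)
    show "(case (vec h, m - vec h) of (a, b) \<Rightarrow> (\<Prod>x\<in>S. f (lookup a x)) * (\<Prod>x\<in>S. g (lookup b x)))
        = (\<Prod>x\<in>S. f (h x) * g (lookup m x - h x))"
      by (simp add: prod.distrib[symmetric] vec lookup_minus)
  next
    fix p assume p: "p \<in> splits m"
    obtain a b where pab: "p = (a, b)" by (cases p)
    with p have ab: "(a, b) \<in> splits m" by simp
    have "lookup (vec (restrict (lookup a) S)) x = lookup a x" for x
      using splits_keys[OF ab] by (auto simp: vec S_def in_keys_iff subset_iff)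
    then have v: "vec (restrict (lookup a) S) = a" by (rule poly_mapping_eqI)
    moreover have "m - a = b" using ab by (auto simp: splits_def)
    ultimately show "(vec (case p of (a, b) \<Rightarrow> restrict (lookup a) S),
        m - vec (case p of (a, b) \<Rightarrow> restrict (lookup a) S)) = p" by (simp add: pab)
    show "(case p of (a, b) \<Rightarrow> restrict (lookup a) S) \<in> (\<Pi>\<^sub>E x\<in>S. {..lookup m x})"
      using ab by (auto simp: pab splits_def lookup_add)
  qed
  also have "\<dots> = scoeff (pser f * pser g) m"
    unfolding times_series.rep_eq
    by (rule sum.cong) (auto simp: pser_superset[of f S] pser_superset[of g S] f g S_def dest!: splits_keys)
  finally show "scoeff (pser f * pser g) m = scoeff (pser (\<lambda>n. \<Sum>i\<le>n. f i * g (n - i))) m" ..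
qed

definition Eser :: "'k::comm_ring_1 series" where
  "Eser = pser (\<lambda>i. if i = 0 then 1 else if i = 1 then - 1 else 0)"

definition Qser :: "'k \<Rightarrow> 'k::comm_ring_1 series" where
  "Qser q = pser (\<lambda>i. q ^ i)"

definition Wser :: "'k \<Rightarrow> 'k::comm_ring_1 series" where
  "Wser q = pser (\<lambda>i. if i = 0 then 1 else 1 - q)"

lemma pser_1: "pser (\<lambda>i. if i = 0 then 1 else 0) = 1"
proof (rule series_eqI)
  fix m :: "nat \<Rightarrow>\<^sub>0 nat"
  show "scoeff (pser (\<lambda>i. if i = 0 then 1 else 0)) m = scoeff (1 :: 'a series) m"
  proof (cases "m = 0")
    case False
    then obtain x where "x \<in> keys m" by (metis keys_eq_empty equals0I)
    then have "scoeff (pser (\<lambda>i. if i = 0 then 1 else 0)) m = (0 :: 'a)"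
      unfolding pser.rep_eq by (intro prod_zero) (auto simp: in_keys_iff)
    then show ?thesis using False by (simp add: one_series.rep_eq)
  qed (simp add: pser.rep_eq one_series.rep_eq)
qed

text \<open>Multiplication by \<open>1 - x\<close> in one variable is the backward
  difference.\<close>

lemma sum_Eser_coeffs:
  fixes f :: "nat \<Rightarrow> 'k::comm_ring_1"
  shows "(\<Sum>i\<le>n. f i * (if n - i = 0 then 1 else if n - i = 1 then - 1 else 0))
    = (f n - (if n = 0 then 0 else f (n - 1)))"
proof (cases n)
  case (Suc k)
  have "(\<Sum>i\<le>k. f i * (if Suc k - i = 0 then 1 else if Suc k - i = 1 then - 1 else 0))
      = (\<Sum>i\<le>k. if i = k then - f i else 0)"
    by (rule sum.cong) auto
  then show ?thesis by (simp add: Suc)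
qed simp

text \<open>In one variable the factor of W is \<open>(1 - q x) / (1 - x)\<close>, that of Q is
  \<open>1 / (1 - q x)\<close> and that of E is \<open>1 - x\<close>.\<close>

lemma Wser_Qser_Eser: "Wser q * (Qser q * Eser) = 1"
proof -
  \<comment> \<open>The factors of W and Q multiply to \<open>1 / (1 - x)\<close>, whose
    coefficients are all 1.\<close>
  have telescope: "(\<Sum>i\<le>n. (if i = 0 then 1 else 1 - q) * q ^ (n - i)) = 1" for n
  proof (induction n)
    case (Suc n)
    have "(\<Sum>i\<le>Suc n. (if i = 0 then 1 else 1 - q) * q ^ (Suc n - i))
        = (\<Sum>i\<le>n. q * ((if i = 0 then 1 else 1 - q) * q ^ (n - i))) + (1 - q)"
      by (auto simp: Suc_diff_le intro!: sum.cong)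
    then show ?case by (simp only: Suc flip: sum_distrib_left) simp
  qed simp
  have "Wser q * Qser q = pser (\<lambda>n. 1)"
    unfolding Wser_def Qser_def by (subst pser_mult) (simp_all only: telescope, simp_all)
  moreover have "pser (\<lambda>n. 1) * Eser = (1 :: 'a series)"
  proof -
    have "(\<lambda>n. 1 - (if n = 0 then 0 else 1) :: 'a) = (\<lambda>n :: nat. if n = 0 then 1 else 0)"
      by (simp add: fun_eq_iff)
    then show ?thesis
      unfolding Eser_def by (subst pser_mult) (simp_all only: sum_Eser_coeffs pser_1, simp_all)
  qed
  ultimately show ?thesis by (simp flip: mult.assoc)
qed

lemma Qser_1_Eser: "Qser 1 * Eser = 1"
  using Wser_Qser_Eser[of 1] by (simp add: Wser_def pser_1 cong: if_cong)

lemma scoeff_Qser: "scoeff (Qser q) a = q ^ deg a"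
  by (simp add: Qser_def pser.rep_eq deg_keys power_sum)

lemma scoeff_Wser: "scoeff (Wser q) a = (1 - q) ^ card (keys a)"
proof -
  have "scoeff (Wser q) a = (\<Prod>x\<in>keys a. 1 - q)"
    unfolding Wser_def pser.rep_eq by (rule prod.cong) (auto simp: in_keys_iff)
  then show ?thesis by simp
qed

text \<open>E is the alternating sum of the \<open>M (ones i)\<close>: a factor \<open>1 - x\<close>
  forbids exponents above 1, and each variable used brings a sign.\<close>

lemma scoeff_Eser: "scoeff Eser a = (-1) ^ deg a * scoeff (M (ones (deg a))) a"
proof (cases "\<forall>x\<in>keys a. lookup a x = 1")
  case True
  then have "deg a = card (keys a)" by (simp add: deg_keys)
  moreover have "exps a = replicate (card (keys a)) 1"
    unfolding exps_def using True by (intro replicate_eqI) auto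
  moreover have "scoeff Eser a = (\<Prod>x\<in>keys a. - 1)"
    unfolding Eser_def pser.rep_eq using True by (intro prod.cong) auto
  ultimately show ?thesis by (simp add: M.rep_eq ones.rep_eq)
next
  case False
  then obtain x where x: "x \<in> keys a" "lookup a x \<noteq> 1" by blast
  then have "lookup a x \<in> set (exps a)" by (simp add: exps_def)
  then have "exps a \<noteq> replicate (deg a) 1" using x by (metis in_set_replicate)
  moreover have "scoeff Eser a = 0"
    unfolding Eser_def pser.rep_eq using x by (intro prod_zero) (auto simp: in_keys_iff)
  ultimately show ?thesis by (simp add: M.rep_eq ones.rep_eq)
qed

section \<open>The creation operators\<close>

lemma nlinear_mult: "nlinear (\<lambda>g. A * g)"
  unfolding nlinear_def
  by (simp add: distrib_left) (metis nconst_central mult.assoc)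

lemma graded_ones: "graded_family (\<lambda>i. M (ones i)) (\<lambda>i g. (-1) ^ i * H (m + int i) * g)"
  by standard (auto simp: M_QSym M.rep_eq deg_def ones.rep_eq sum_list_replicate nlinear_mult split: if_splits)

lemma BB_creation: "BB m = graded_family.creation (\<lambda>i. M (ones i)) (\<lambda>i g. (-1) ^ i * H (m + int i) * g)"
  by (rule ext) (simp add: BB_def graded_family.creation_def[OF graded_ones])

lemma BB_nlinear: "nlinear (BB m)"
  unfolding BB_creation by (rule graded_family.creation_nlinear[OF graded_ones])

lemma nconst_power: "nconst (c ^ n) = nconst c ^ n"
  by (induction n) (simp_all add: nconst_mult)

lemma BB_hm: "BB m (hm y) = conv nscale Eser (\<lambda>d b. H (m + int d) * hm b) y"
  unfolding BB_creation graded_family.creation_hm[OF graded_ones] conv_def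
  by (rule sum.cong)
    (auto simp: scoeff_Eser nscale_def nconst_mult nconst_power nconst_minus nconst_central mult.assoc)

lemma graded_Fq: "graded_family Fq (\<lambda>i g. nconst (q ^ i) * BB (m + int i) g)"
proof
  show "nlinear (\<lambda>g. nconst (q ^ i) * BB (m + int i) g)" for i
    unfolding nlinear_def
    by (auto simp: nlinear_add[OF BB_nlinear] nlinear_nconst[OF BB_nlinear] distrib_left)
      (metis nconst_central mult.assoc)
qed (auto simp: Fq_QSym scoeff_Fq split: if_splits)

lemma BBq_creation: "BBq q m = graded_family.creation Fq (\<lambda>i g. nconst (q ^ i) * BB (m + int i) g)"
  by (rule ext) (simp add: BBq_def graded_family.creation_def[OF graded_Fq])

lemma BBq_nlinear: "nlinear (BBq q m)"
  unfolding BBq_creation by (rule graded_family.creation_nlinear[OF graded_Fq])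

lemma BBq_hm_BB: "BBq q m (hm y) = conv nscale (Qser q) (\<lambda>d b. BB (m + int d) (hm b)) y"
  unfolding BBq_creation graded_family.creation_hm[OF graded_Fq] conv_def
  by (rule sum.cong) (auto simp: scoeff_Fq scoeff_Qser nscale_def)

lemma BBq_hm: "BBq q m (hm y) = conv nscale (Qser q * Eser) (\<lambda>d b. H (m + int d) * hm b) y"
  unfolding BBq_hm_BB BB_hm
  by (subst conv_conv[OF module_nscale, symmetric]) (simp add: add.assoc)

text \<open>Inverts \<open>BBq_hm\<close>: convolution with W undoes that with QE, and only the term
  of degree 0 survives. This will express generators through the deformed operators.\<close>

lemma H_mult_hm: "H m * hm y = conv nscale (Wser q) (\<lambda>d b. BBq q (m + int d) (hm b)) y"
proof -
  have "conv nscale (Wser q) (\<lambda>d b. BBq q (m + int d) (hm b)) y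
      = conv nscale (Wser q) (\<lambda>d. conv nscale (Qser q * Eser) (\<lambda>e b. H (m + int (d + e)) * hm b)) y"
    by (simp add: BBq_hm add.assoc)
  also have "\<dots> = conv nscale 1 (\<lambda>d b. H (m + int d) * hm b) y"
    by (subst conv_conv[OF module_nscale]) (simp add: Wser_Qser_Eser)
  finally show ?thesis by (simp add: conv_1[OF module_nscale])
qed

lemma nlinear_eqI:
  assumes "nlinear \<phi>" "nlinear \<psi>" "\<And>y. \<phi> (hm y) = \<psi> (hm y)"
  shows "\<phi> f = \<psi> f"
  by (induction f rule: nsym_induct)
    (simp_all add: assms(3) nlinear_0[OF assms(1)] nlinear_0[OF assms(2)] nlinear_add[OF assms(1)]
      nlinear_add[OF assms(2)] nlinear_nconst[OF assms(1)] nlinear_nconst[OF assms(2)])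

lemma BBq_1: "BBq 1 m f = H m * f"
  by (rule nlinear_eqI[OF BBq_nlinear nlinear_mult])
    (simp add: BBq_hm Qser_1_Eser conv_1[OF module_nscale])

lemma Qser_0: "Qser 0 = 1"
proof -
  have "(\<lambda>i. 0 ^ i :: 'a) = (\<lambda>i. if i = 0 then 1 else 0)" by (simp add: fun_eq_iff power_0_left)
  then show ?thesis by (simp add: Qser_def pser_1)
qed

lemma BBq_0: "BBq 0 m f = BB m f"
  by (rule nlinear_eqI[OF BBq_nlinear BB_nlinear])
    (simp add: BBq_hm_BB Qser_0 conv_1[OF module_nscale])

section \<open>Peeling off the first row of a tableau\<close>

definition vecof :: "nat list \<Rightarrow> nat \<Rightarrow>\<^sub>0 nat" where
  "vecof r = (\<Sum>x\<leftarrow>r. single x 1)"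

lemma lookup_vecof: "lookup (vecof r) i = count_list r i"
  by (induction r) (simp_all add: vecof_def lookup_add lookup_single when_def)

lemma keys_vecof: "keys (vecof r) = set r"
  by (auto simp: in_keys_iff lookup_vecof count_list_0_iff)

lemma deg_single [simp]: "deg (single k n) = n"
  by (simp add: deg_superset[of "{k}"])

lemma deg_vecof: "deg (vecof r) = length r"
  by (induction r) (simp_all add: vecof_def deg_add)

lemma vecof_eqI: "(\<And>i. count_list r i = lookup y i) \<Longrightarrow> vecof r = y"
  by (rule poly_mapping_eqI) (simp add: lookup_vecof)

lemma vecof_inject:
  assumes "sorted r" "sorted r'" "vecof r = vecof r'"
  shows "r = r'"
proof -
  have "mset r = mset r'"
    by (rule multiset_eqI) (metis assms(3) count_mset lookup_vecof)
  with assms show ?thesis by (metis sorted_sort_id sorted_list_of_multiset_mset)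
qed

text \<open>Inverse of \<open>vecof\<close> on weakly increasing rows.\<close>

definition row_of :: "(nat \<Rightarrow>\<^sub>0 nat) \<Rightarrow> nat list" where
  "row_of v = sorted_list_of_multiset (\<Sum>x\<in>keys v. replicate_mset (lookup v x) x)"

lemma sorted_row_of: "sorted (row_of v)"
  by (simp add: row_of_def)

lemma vecof_row_of [simp]: "vecof (row_of v) = v"
proof (rule vecof_eqI)
  fix i
  have "count_list (row_of v) i = count (\<Sum>x\<in>keys v. replicate_mset (lookup v x) x) i"
    unfolding row_of_def by (metis count_mset mset_sorted_list_of_multiset)
  also have "\<dots> = (\<Sum>x\<in>keys v. if x = i then lookup v x else 0)"
    by (simp add: count_sum)
  finally show "count_list (row_of v) i = lookup v i"
    by (simp add: in_keys_iff)
qed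

lemma row_of_vecof: "sorted r \<Longrightarrow> row_of (vecof r) = r"
  by (rule vecof_inject) (simp_all add: sorted_row_of)

lemma set_row_of: "set (row_of v) = keys v"
  using keys_vecof[of "row_of v"] by simp

lemma length_row_of: "length (row_of v) = deg v"
  using deg_vecof[of "row_of v"] by simp

lemma vecof_append: "vecof (r @ s) = vecof r + vecof s"
  by (simp add: vecof_def)

text \<open>Contents are arbitrary exponent vectors here, so that the rows below the first one form
  again such a tableau, without renumbering of the entries.\<close>

definition tabs :: "nat list \<Rightarrow> (nat \<Rightarrow>\<^sub>0 nat) \<Rightarrow> nat list list set" where
  "tabs as y = {T. map length T = as \<and> (\<forall>r\<in>set T. sorted r) \<and> sorted_wrt (<) (map hd T) \<and>
     vecof (concat T) = y}"

lemma deg_tabs: "T \<in> tabs as y \<Longrightarrow> deg y = sum_list as"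
  by (auto simp: tabs_def deg_vecof length_concat)

lemma tabs_Nil: "tabs [] y = (if y = 0 then {[]} else {})"
  by (auto simp: tabs_def vecof_def)

lemma hd_le_sorted: "sorted r \<Longrightarrow> x \<in> set r \<Longrightarrow> hd r \<le> x"
  by (cases r) auto

text \<open>Here \<open>k\<close> is the least variable of \<open>y\<close> and \<open>n\<close> its
  exponent; read as a content, the least entry \<open>k\<close> occurs \<open>n\<close>
  times.\<close>

context
  fixes k n :: nat and y' y :: "nat \<Rightarrow>\<^sub>0 nat"
  assumes n: "0 < n" and k: "\<And>x. x \<in> keys y' \<Longrightarrow> k < x" and y: "y = single k n + y'"
begin

lemma exps_least: "exps y = n # exps y'"
proof -
  let ?ks = "sorted_list_of_set (keys y')"
  have "exps y = filter ((\<noteq>) 0) (map (lookup y) (k # ?ks))"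
  proof (rule exps_filter)
    show "sorted (k # ?ks)" using k by (auto intro: less_imp_le)
    show "distinct (k # ?ks)" using k by auto
    show "keys y \<subseteq> set (k # ?ks)" by (auto simp: y keys_add_nat split: if_splits)
  qed
  moreover have "map (lookup y) ?ks = exps y'"
    unfolding exps_def using k by (auto simp: y lookup_add lookup_single when_def)
  ultimately have "exps y = filter ((\<noteq>) 0) (lookup y k # exps y')"
    by simp
  moreover have "lookup y k = n" using k[of k] by (auto simp: y lookup_add in_keys_iff)
  moreover have "filter ((\<noteq>) 0) (exps y') = exps y'"
    using exps_pos by (auto simp: filter_id_conv)
  ultimately show ?thesis using n by simp
qed

lemma row_of_least: "c + d = y' \<Longrightarrow> hd (row_of (single k n + c)) = k"
proof -
  assume cd: "c + d = y'"
  let ?r = "row_of (single k n + c)"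
  have set: "set ?r = insert k (keys c)" using n by (auto simp: set_row_of keys_add_nat)
  have "hd ?r \<in> set ?r" using set by (metis empty_iff insertI1 list.set(1) list.set_sel(1))
  moreover have "hd ?r \<le> k" by (rule hd_le_sorted) (auto simp: sorted_row_of set)
  moreover have "k < x" if "x \<in> keys c" for x using that k cd by (auto simp: keys_add_nat)
  ultimately show ?thesis using set by force
qed

text \<open>Rows increase weakly and their heads strictly, so all \<open>n\<close> copies of the
  least entry \<open>k\<close> lie in the first row. The rest of that row is an arbitrary
  \<open>c\<close> of the right size, and the lower rows form a tableau of the remaining content
  \<open>d\<close>.\<close>

lemma tabs_Cons_bij:
  assumes a: "0 < a" and as: "\<forall>x\<in>set as. 0 < x"
  shows "bij_betw (\<lambda>((c, d), T). row_of (single k n + c) # T)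
    (Sigma {(c, d)\<in>splits y'. n + deg c = a} (\<lambda>(c, d). tabs as d)) (tabs (a # as) y)"
    (is "bij_betw ?j ?S _")
proof (rule bij_betw_imageI)
  show "inj_on ?j ?S"
  proof (rule inj_onI)
    fix p p' assume p: "p \<in> ?S" "p' \<in> ?S" "?j p = ?j p'"
    obtain c d T c' d' T' where [simp]: "p = ((c, d), T)" "p' = ((c', d'), T')"
      by (metis prod.exhaust)
    have "vecof (row_of (single k n + c)) = vecof (row_of (single k n + c'))" using p by simp
    then have "c = c'" by simp
    moreover have "d = d'" "T = T'" using p by (auto simp: tabs_def)
    ultimately show "p = p'" by simp
  qed
  show "?j ` ?S = tabs (a # as) y"
  proof (intro subset_antisym subsetI)
    fix U assume "U \<in> ?j ` ?S"
    then obtain c d T where cd: "c + d = y'" "n + deg c = a" and T: "T \<in> tabs as d"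
      and U: "U = row_of (single k n + c) # T" by (auto simp: splits_def)
    \<comment> \<open>Positive row lengths make \<open>hd r\<close> an actual entry, hence a
      variable of \<open>d\<close>, and these exceed \<open>k\<close>.\<close>
    have "k < hd r" if r: "r \<in> set T" for r
    proof -
      have "length r \<in> set as" using T r by (auto simp: tabs_def)
      then have "hd r \<in> set r" using as by auto
      then have "hd r \<in> set (concat T)" using r by auto
      then have "hd r \<in> keys d" using T by (auto simp: tabs_def keys_vecof)
      then show ?thesis using k cd by (auto simp: keys_add_nat)
    qed
    then show "U \<in> tabs (a # as) y"
      using T cd row_of_least[OF cd(1)]
      by (auto simp: tabs_def U length_row_of deg_add sorted_row_of vecof_append y add.assoc)
  next
    fix U assume U: "U \<in> tabs (a # as) y"
    then obtain r T where rT: "U = r # T" by (auto simp: tabs_def)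
    have r: "length r = a" "sorted r" and hds: "\<And>s. s \<in> set T \<Longrightarrow> hd r < hd s"
      and sT: "\<And>s. s \<in> set T \<Longrightarrow> sorted s" and vec: "vecof r + vecof (concat T) = y"
      using U by (auto simp: tabs_def rT vecof_append)
    have "hd r \<in> set r" using r a by auto
    then have "hd r \<in> keys y" by (simp flip: vec add: keys_add_nat keys_vecof)
    then have "k \<le> hd r" using k by (force simp: y keys_add_nat split: if_splits)
    \<comment> \<open>A lower row containing \<open>k\<close> would have a head of at most
      \<open>k\<close>, yet this head exceeds \<open>hd r\<close>, which is at least
      \<open>k\<close>.\<close>
    have "k \<notin> set (concat T)"
    proof
      assume "k \<in> set (concat T)"
      then obtain s where s: "s \<in> set T" "k \<in> set s" by auto
      then show False using hds[of s] hd_le_sorted[of s k] sT \<open>k \<le> hd r\<close> by fastforce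
    qed
    then have kT: "lookup (vecof (concat T)) k = 0" by (simp add: lookup_vecof count_list_0_iff)
    have "lookup y k = n" using k[of k] by (auto simp: y lookup_add in_keys_iff)
    with kT have kr: "lookup (vecof r) k = n" by (simp flip: vec add: lookup_add)
    \<comment> \<open>Subtraction truncates at 0; \<open>kr\<close> ensures that nothing is
      lost.\<close>
    define c where "c = vecof r - single k n"
    have c: "single k n + c = vecof r"
      by (rule poly_mapping_eqI) (auto simp: c_def lookup_add lookup_minus lookup_single when_def kr)
    then have "single k n + (c + vecof (concat T)) = single k n + y'"
      using vec by (simp add: y flip: add.assoc)
    then have "c + vecof (concat T) = y'" by simp
    moreover have "n + deg c = a" using arg_cong[OF c, of deg] r by (simp add: deg_add deg_vecof)
    moreover have "T \<in> tabs as (vecof (concat T))" using U by (auto simp: tabs_def rT)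
    moreover have "U = row_of (single k n + c) # T" by (simp add: rT c row_of_vecof r)
    ultimately show "U \<in> ?j ` ?S" by (force simp: splits_def)
  qed
qed

text \<open>Besides \<open>k\<close>, the distinct entries of the first row are the variables of
  \<open>c\<close>; the \<open>- 1\<close> in \<open>nT\<close> discounts \<open>k\<close>.\<close>

lemma nT_row_of: "c + d = y' \<Longrightarrow> nT (row_of (single k n + c) # T) = card (keys c) + nT T"
proof -
  assume cd: "c + d = y'"
  have "k \<notin> keys c" using k[of k] cd by (auto simp: keys_add_nat)
  moreover have "keys (single k n + c) = insert k (keys c)" using n by (auto simp: keys_add_nat)
  ultimately show ?thesis by (simp add: nT_def set_row_of)
qed

end

lemma least_decomp:
  assumes "y \<noteq> 0"
  obtains k n y' where "0 < n" "\<And>x. x \<in> keys y' \<Longrightarrow> k < x" "y = single k n + (y' :: nat \<Rightarrow>\<^sub>0 nat)"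
proof -
  define k where "k = Min (keys y)"
  have ne: "keys y \<noteq> {}" using assms by simp
  then have k: "k \<in> keys y" by (simp add: k_def)
  define y' where "y' = y - single k (lookup y k)"
  have "y = single k (lookup y k) + y'"
    by (rule poly_mapping_eqI) (simp add: y'_def lookup_add lookup_minus lookup_single when_def)
  moreover have "k < x" if "x \<in> keys y'" for x
  proof -
    have "x \<noteq> k" "x \<in> keys y"
      using that by (auto simp: y'_def in_keys_iff lookup_minus lookup_single when_def split: if_splits)
    then show ?thesis using Min_le[of "keys y" x] by (simp add: k_def le_neq_implies_less)
  qed
  moreover have "0 < lookup y k" using k by (simp add: in_keys_iff)
  ultimately show ?thesis using that by blast
qed

lemma tabs_Cons_0: "0 < a \<Longrightarrow> tabs (a # as) 0 = {}"
  using deg_tabs[of _ "a # as" 0] by auto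

lemma finite_tabs: "\<forall>x\<in>set as. 0 < x \<Longrightarrow> finite (tabs as y)"
proof (induction as arbitrary: y)
  case Nil
  then show ?case by (simp add: tabs_Nil)
next
  case (Cons a as)
  show ?case
  proof (cases "y = 0")
    case True
    with Cons show ?thesis by (simp add: tabs_Cons_0)
  next
    case False
    then obtain k n y' where d: "0 < n" "\<And>x. x \<in> keys y' \<Longrightarrow> k < x" "y = single k n + y'"
      using least_decomp by blast
    have "finite (Sigma {(c, d)\<in>splits y'. n + deg c = a} (\<lambda>(c, d). tabs as d))"
      by (rule finite_SigmaI) (use Cons finite_splits in \<open>auto intro: rev_finite_subset\<close>)
    then show ?thesis using tabs_Cons_bij[OF d, of a as] Cons.prems by (simp add: bij_betw_finite)
  qed
qed

section \<open>Weighted tableau sums as quasisymmetric functions\<close>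

definition tabsum :: "'k::comm_ring_1 \<Rightarrow> nat list \<Rightarrow> (nat \<Rightarrow>\<^sub>0 nat) \<Rightarrow> 'k" where
  "tabsum q as y = (\<Sum>T\<in>tabs as y. (1 - q) ^ nT T)"

lemma tabsum_Nil: "tabsum q [] y = (if y = 0 then 1 else 0)"
  by (simp add: tabsum_def tabs_Nil nT_def)

text \<open>The weight of the removed row is the coefficient of W at \<open>c\<close>. The condition
  on its length involves only \<open>deg c\<close>, so it can be absorbed into the convolved
  functional.\<close>

lemma tabsum_Cons:
  assumes d: "0 < n" "\<And>x. x \<in> keys y' \<Longrightarrow> k < x" "y = single k n + y'"
    and a: "0 < a" "\<forall>x\<in>set as. 0 < x"
  shows "tabsum q (a # as) y = conv (*) (Wser q) (\<lambda>e b. if n + e = a then tabsum q as b else 0) y'"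
proof -
  let ?D = "{(c, d)\<in>splits y'. n + deg c = a}"
  have fin: "finite ?D" by (rule finite_subset[OF _ finite_splits[of y']]) auto
  have "tabsum q (a # as) y
      = (\<Sum>p\<in>Sigma ?D (\<lambda>(c, d). tabs as d). (1 - q) ^ nT ((\<lambda>((c, d), T). row_of (single k n + c) # T) p))"
    unfolding tabsum_def by (rule sum.reindex_bij_betw[OF tabs_Cons_bij[OF d a], symmetric])
  also have "\<dots> = (\<Sum>((c, d), T)\<in>Sigma ?D (\<lambda>(c, d). tabs as d). (1 - q) ^ card (keys c) * (1 - q) ^ nT T)"
  proof (rule sum.cong[OF refl], clarsimp)
    fix c e T assume "(c, e) \<in> splits y'"
    then have "c + e = y'" by (simp add: splits_def)
    then show "(1 - q) ^ nT (row_of (single k n + c) # T) = (1 - q) ^ card (keys c) * (1 - q) ^ nT T"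
      by (simp only: nT_row_of[OF d] power_add)
  qed
  also have "\<dots> = (\<Sum>(c, d)\<in>?D. (1 - q) ^ card (keys c) * tabsum q as d)"
    using finite_tabs[OF a(2)]
    by (subst sum.Sigma[OF fin, symmetric]) (auto simp: tabsum_def sum_distrib_left case_prod_unfold)
  also have "\<dots> = (\<Sum>(c, d)\<in>splits y'. (1 - q) ^ card (keys c) * (if n + deg c = a then tabsum q as d else 0))"
    by (rule sum.mono_neutral_cong_left[OF finite_splits]) (auto split: if_splits)
  finally show ?thesis by (simp add: conv_def scoeff_Wser)
qed

lemma exps_eq_Nil: "exps y = [] \<longleftrightarrow> y = 0"
  by (simp add: exps_def)

lemma card_keys_exps: "card (keys c) = length (exps c)"
  by (simp add: exps_def)

text \<open>Only the relative order of the entries matters, not their values. The induction removes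
  the first row from both sides; the convolution that arises is again determined by exponent
  lists.\<close>

lemma tabsum_exps_cong:
  "\<forall>x\<in>set as. 0 < x \<Longrightarrow> exps y = exps z \<Longrightarrow> tabsum q as y = tabsum q as z"
proof (induction as arbitrary: y z)
  case Nil
  then show ?case by (metis tabsum_Nil exps_eq_Nil)
next
  case (Cons a as)
  show ?case
  proof (cases "y = 0")
    case True
    with Cons show ?thesis by (metis exps_eq_Nil)
  next
    case False
    with Cons have "z \<noteq> 0" by (metis exps_eq_Nil)
    obtain k n y' where y: "0 < n" "\<And>x. x \<in> keys y' \<Longrightarrow> k < x" "y = single k n + y'"
      using least_decomp[OF False] by blast
    obtain l m z' where z: "0 < m" "\<And>x. x \<in> keys z' \<Longrightarrow> l < x" "z = single l m + z'"
      using least_decomp[OF \<open>z \<noteq> 0\<close>] by blast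
    have eq: "n = m" "exps y' = exps z'"
      using exps_least[OF y] exps_least[OF z] Cons.prems by auto
    \<comment> \<open>\<open>sum_splits_exps\<close> asks for functions of exponent lists; for the
      lower rows the induction hypothesis supplies one.\<close>
    let ?f = "\<lambda>es. if n + sum_list es = a then (1 - q) ^ length es else 0"
    let ?g = "\<lambda>es. tabsum q as (Poly_Mapping.nth es)"
    have g: "?g (exps d) = tabsum q as d" for d
      by (rule Cons.IH) (use Cons.prems in auto)
    have "conv (*) (Wser q) (\<lambda>e b. if n + e = a then tabsum q as b else 0) x
        = (\<Sum>(u, v)\<in>lsplits (exps x). ?f (filter ((\<noteq>) 0) u) * ?g (filter ((\<noteq>) 0) v))" for x
    proof -
      have "conv (*) (Wser q) (\<lambda>e b. if n + e = a then tabsum q as b else 0) x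
          = (\<Sum>(c, d)\<in>splits x. ?f (exps c) * ?g (exps d))"
        unfolding conv_def g by (rule sum.cong) (auto simp: scoeff_Wser card_keys_exps simp flip: deg_def)
      also have "\<dots> = (\<Sum>(u, v)\<in>lsplits (exps x). ?f (filter ((\<noteq>) 0) u) * ?g (filter ((\<noteq>) 0) v))"
        by (rule sum_splits_exps)
      finally show ?thesis .
    qed
    then show ?thesis
      using Cons.prems tabsum_Cons[OF y, of a as q] tabsum_Cons[OF z, of a as q] eq by simp
  qed
qed

lift_definition tabser :: "'k::comm_ring_1 \<Rightarrow> nat list \<Rightarrow> 'k series" is "tabsum" .

lemma tabser_quasi: "\<forall>x\<in>set as. 0 < x \<Longrightarrow> quasi (tabser q as)"
  unfolding quasi_def tabser.rep_eq using tabsum_exps_cong by blast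

lemma tabser_QSym:
  assumes "\<forall>x\<in>set as. 0 < x"
  shows "tabser q as \<in> QSym"
proof -
  have "deg y \<le> sum_list as" if "scoeff (tabser q as) y \<noteq> 0" for y
  proof -
    have "tabs as y \<noteq> {}" using that by (auto simp: tabser.rep_eq tabsum_def)
    then show ?thesis using deg_tabs by fastforce
  qed
  then show ?thesis using tabser_quasi[OF assms] by (auto simp: QSym_iff)
qed

text \<open>Variable 0 is absent from \<open>shifted \<beta>\<close>, so this content encodes both
  the positivity of the entries and their multiplicities.\<close>

lemma tabs_shifted:
  "T \<in> tabs (parts \<alpha>) (shifted \<beta>) \<longleftrightarrow> immaculate_tableau \<alpha> \<beta> T"
proof -
  have "vecof (concat T) = shifted \<beta> \<longleftrightarrow> (\<forall>x\<in>set (concat T). 0 < x) \<and> has_content T \<beta>"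
  proof
    assume v: "vecof (concat T) = shifted \<beta>"
    have c: "count_list (concat T) i = lookup (shifted \<beta>) i" for i
      by (simp flip: lookup_vecof add: v)
    have "0 \<notin> set (concat T)"
      using zero_notin_shifted[of \<beta>] unfolding v[symmetric] keys_vecof .
    then show "(\<forall>x\<in>set (concat T). 0 < x) \<and> has_content T \<beta>"
      unfolding has_content_def c lookup_shifted by (metis gr0I not_less not_one_le_zero)
  next
    assume h: "(\<forall>x\<in>set (concat T). 0 < x) \<and> has_content T \<beta>"
    show "vecof (concat T) = shifted \<beta>"
    proof (rule vecof_eqI)
      fix i
      have "0 \<notin> set (concat T)" using h by blast
      then have "count_list (concat T) 0 = 0" by (simp only: count_list_0_iff) simp
      then show "count_list (concat T) i = lookup (shifted \<beta>) i"
        using h by (cases "i = 0") (auto simp: has_content_def lookup_shifted)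
    qed
  qed
  then show ?thesis unfolding tabs_def immaculate_tableau_def by blast
qed

text \<open>At the monomial \<open>y\<close> exactly the tableaux of content
  \<open>comp_of y\<close> contribute on the right. On the left, \<open>y\<close> may be replaced by
  \<open>shifted (comp_of y)\<close>, which turns \<open>tabs\<close> into these tableaux.\<close>

lemma tabser_tableaux:
  "tabser q (parts \<alpha>) = (\<Sum>T\<in>immaculate_tableaux \<alpha>. scale ((1 - q) ^ nT T) (M (tab_content T)))"
proof (rule series_eqI)
  fix y
  have pos: "\<forall>x\<in>set (parts \<alpha>). 0 < x" using parts[of \<alpha>] by simp
  have "tabs (parts \<alpha>) (shifted (comp_of y)) = {T \<in> immaculate_tableaux \<alpha>. exps y = parts (tab_content T)}"
  proof (intro set_eqI iffI)
    fix T assume "T \<in> tabs (parts \<alpha>) (shifted (comp_of y))"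
    then have T: "immaculate_tableau \<alpha> (comp_of y) T" by (simp add: tabs_shifted)
    then have "tab_content T = comp_of y" by (intro tab_content_eq) (simp add: immaculate_tableau_def)
    with T show "T \<in> {T \<in> immaculate_tableaux \<alpha>. exps y = parts (tab_content T)}"
      by (auto simp: immaculate_tableaux_def)
  next
    fix T assume "T \<in> {T \<in> immaculate_tableaux \<alpha>. exps y = parts (tab_content T)}"
    then obtain \<beta> where T: "immaculate_tableau \<alpha> \<beta> T" and e: "exps y = parts (tab_content T)"
      by (auto simp: immaculate_tableaux_def)
    have "tab_content T = \<beta>" using T by (intro tab_content_eq) (simp add: immaculate_tableau_def)
    with e have "comp_of y = \<beta>" by (simp add: comp_of_def parts_inverse)
    with T show "T \<in> tabs (parts \<alpha>) (shifted (comp_of y))" by (simp add: tabs_shifted)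
  qed
  then have "tabsum q (parts \<alpha>) (shifted (comp_of y))
      = (\<Sum>T\<in>immaculate_tableaux \<alpha>. if exps y = parts (tab_content T) then (1 - q) ^ nT T else 0)"
    unfolding tabsum_def
    by (simp add: sum.inter_filter[symmetric] finite_immaculate_tableaux)
  moreover have "tabsum q (parts \<alpha>) (shifted (comp_of y)) = tabsum q (parts \<alpha>) y"
    by (rule tabsum_exps_cong[OF pos]) simp
  ultimately show "scoeff (tabser q (parts \<alpha>)) y
      = scoeff (\<Sum>T\<in>immaculate_tableaux \<alpha>. scale ((1 - q) ^ nT T) (M (tab_content T))) y"
    by (simp add: tabser.rep_eq scoeff_sum scale.rep_eq M.rep_eq if_distrib cong: if_cong)
qed

section \<open>Duality\<close>

lemma H_mult_hm_eq:
  assumes "0 < k" "exps y = k # exps b"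
  shows "H (int k) * hm b = hm y"
proof -
  have "one_part k + comp_of b = comp_of y"
    using assms by (simp add: parts_inject[symmetric] plus_composition.rep_eq one_part.rep_eq)
  then show ?thesis by (simp add: H_def hm_def mult_single)
qed

lemma splits_subset: "(a, b) \<in> splits y \<Longrightarrow> x \<notin> keys y \<Longrightarrow> x \<notin> keys b"
  using splits_keys by blast

text \<open>Variable 0 precedes all variables of \<open>b\<close>, so the new first part can be
  recorded there. This prepares \<open>tabsum_Cons\<close> with least entry 0.\<close>

lemma pairing_H_hm:
  assumes "quasi F" "0 < k" "0 \<notin> keys b"
  shows "pairing (H (int k) * hm b) F = scoeff F (single 0 k + b)"
proof -
  have "x \<in> keys b \<Longrightarrow> 0 < x" for x using assms(3) by (metis gr0I)
  from exps_least[OF assms(2) this refl] have "exps (single 0 k + b) = k # exps b" .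
  with assms show ?thesis by (simp add: H_mult_hm_eq pairing_hm)
qed

lemma pairing_conv:
  "pairing (conv nscale F X y) G = conv (*) F (\<lambda>d b. pairing (X d b) G) y"
  by (simp add: conv_def pairing_sum nscale_def pairing_nconst case_prod_unfold)

text \<open>The operator convolves with QE and removing the first row convolves with W. These
  cancel, leaving the term of degree 0, where the length condition reads
  \<open>m = a\<close>.\<close>

lemma pairing_BBq:
  assumes m: "0 < m" and as: "\<forall>x\<in>set as. 0 < x"
  shows "pairing (BBq q (int m) f) (tabser q as)
    = (case as of [] \<Rightarrow> 0 | a # as' \<Rightarrow> if m = a then pairing f (tabser q as') else 0)"
proof (induction f rule: nsym_induct)
  case zero
  show ?case by (simp add: nlinear_0[OF BBq_nlinear] split: list.split)
next
  case (add f g)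
  then show ?case by (simp add: nlinear_add[OF BBq_nlinear] pairing_add split: list.splits)
next
  case (hm c y)
  note quasi = tabser_quasi[OF as, of q]
  have "pairing (BBq q (int m) (hm y)) (tabser q as)
      = conv (*) (Qser q * Eser) (\<lambda>d b. pairing (H (int (m + d)) * hm b) (tabser q as)) y"
    by (simp add: BBq_hm pairing_conv)
  also have "\<dots> = conv (*) (Qser q * Eser) (\<lambda>d b. tabsum q as (single 0 (m + d) + b)) y"
    by (rule conv_cong, subst pairing_H_hm[OF quasi])
      (use m hm splits_subset in \<open>auto simp: tabser.rep_eq\<close>)
  also have "\<dots> = (case as of [] \<Rightarrow> 0 | a # as' \<Rightarrow> if m = a then tabsum q as' y else 0)"
  proof (cases as)
    case Nil
    \<comment> \<open>The empty shape admits only the empty content, which is excluded by positivity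
      of \<open>m\<close>.\<close>
    have "single 0 (m + d) + b \<noteq> 0" for d and b :: "nat \<Rightarrow>\<^sub>0 nat"
    proof
      assume "single 0 (m + d) + b = 0"
      then have "deg (single 0 (m + d) + b) = 0" by simp
      with m show False by (simp add: deg_add)
    qed
    then show ?thesis by (simp add: Nil tabsum_Nil conv_def)
  next
    case (Cons a as')
    have "conv (*) (Qser q * Eser) (\<lambda>d b. tabsum q as (single 0 (m + d) + b)) y
      = conv (*) (Qser q * Eser) (\<lambda>d. conv (*) (Wser q)
          (\<lambda>e b. if m + (d + e) = a then tabsum q as' b else 0)) y"
    proof (rule conv_cong)
      fix c b assume cb: "(c, b) \<in> splits y"
      have "0 < x" if "x \<in> keys b" for x using that splits_subset[OF cb] hm by (metis gr0I)
      from tabsum_Cons[OF _ this refl, where n = "m + deg c" and a = a and as = as' and q = q]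
      show "tabsum q as (single 0 (m + deg c) + b) = conv (*) (Wser q)
          (\<lambda>e b. if m + (deg c + e) = a then tabsum q as' b else 0) b"
        using m as by (simp add: Cons add.assoc)
    qed
    also have "\<dots> = conv (*) 1 (\<lambda>d b. if m + d = a then tabsum q as' b else 0) y"
      using Wser_Qser_Eser[of q] by (subst conv_conv[OF module_times]) (simp add: mult.commute)
    finally show ?thesis by (simp add: Cons conv_1[OF module_times])
  qed
  finally have "pairing (BBq q (int m) (hm y)) (tabser q as)
      = (case as of [] \<Rightarrow> 0 | a # as' \<Rightarrow> if m = a then tabsum q as' y else 0)" .
  moreover have "pairing (hm y) (tabser q as') = tabsum q as' y" if "as = a # as'" for a as'
    using as that by (simp add: pairing_hm tabser_quasi tabser.rep_eq)
  ultimately show ?case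
    by (auto simp: nlinear_nconst[OF BBq_nlinear] pairing_nconst split: list.split)
qed

lemma hm_0: "hm 0 = 1"
  by (simp add: hm_def comp_of_def exps_def zero_composition_def[symmetric])

text \<open>Induction on \<open>\<beta>\<close> with \<open>\<alpha>\<close> arbitrary: the
  outermost operator strips the first row if its index is the length of that row, and otherwise
  gives 0.\<close>

lemma pairing_Qprime:
  "pairing (Qprime q \<beta>) (tabser q (parts \<alpha>)) = (if \<beta> = \<alpha> then 1 else 0)"
proof -
  have "pairing (foldr (\<lambda>a. BBq q (int a)) bs 1) (tabser q as) = (if bs = as then 1 else 0)"
    if "\<forall>x\<in>set as. 0 < x" "\<forall>x\<in>set bs. 0 < x" for as bs
    using that
  proof (induction bs arbitrary: as)
    case Nil
    have "pairing (hm 0) (tabser q as) = tabsum q as 0"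
      using Nil by (simp add: pairing_hm tabser_quasi tabser.rep_eq)
    moreover have "tabsum q as 0 = (if [] = as then 1 else 0)"
      using Nil by (cases as) (simp_all add: tabsum_Nil, simp add: tabsum_def tabs_Cons_0)
    ultimately show ?case by (simp add: hm_0)
  next
    case (Cons b bs)
    then show ?case by (auto simp: pairing_BBq split: list.split)
  qed
  from this[of "parts \<alpha>" "parts \<beta>"] show ?thesis
    using parts[of \<alpha>] parts[of \<beta>] by (simp add: Qprime_def parts_inject)
qed

section \<open>Spanning and uniqueness of the dual basis\<close>

interpretation nsym: module nscale
  by (rule module_nscale)

lemma BBq_Qprime: "0 < m \<Longrightarrow> BBq q (int m) (Qprime q \<beta>) = Qprime q (one_part m + \<beta>)"
  by (simp add: Qprime_def plus_composition.rep_eq one_part.rep_eq)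

lemma BBq_span:
  assumes m: "0 < m" and f: "f \<in> nsym.span (range (Qprime q))"
  shows "BBq q (int m) f \<in> nsym.span (range (Qprime q))"
  using f
proof (induction rule: nsym.span_induct_alt)
  case base
  show ?case by (simp add: nlinear_0[OF BBq_nlinear] nsym.span_zero)
next
  case (step c x g)
  then obtain \<beta> where "x = Qprime q \<beta>" by blast
  then have "BBq q (int m) x \<in> nsym.span (range (Qprime q))"
    using m by (simp add: BBq_Qprime nsym.span_base)
  then show ?case
    using step by (simp add: nlinear_add[OF BBq_nlinear] nscale_def nlinear_nconst[OF BBq_nlinear])
      (simp add: nsym.span_add nsym.span_scale flip: nscale_def)
qed

text \<open>Induction on the degree: \<open>H_mult_hm\<close> reduces to deformed operators applied
  to generators of smaller degree, because the positive first part \<open>n\<close> has been split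
  off.\<close>

lemma hm_span: "hm y \<in> nsym.span (range (Qprime q))"
proof (induction "deg y" arbitrary: y rule: less_induct)
  case less
  show ?case
  proof (cases "y = 0")
    case True
    have "Qprime q 0 = 1" by (simp add: Qprime_def zero_composition.rep_eq)
    with True show ?thesis by (metis hm_0 nsym.span_base rangeI)
  next
    case False
    then obtain k n y' where d: "0 < n" "\<And>x. x \<in> keys y' \<Longrightarrow> k < x" "y = single k n + y'"
      using least_decomp by blast
    have "hm y = H (int n) * hm y'"
      using H_mult_hm_eq[OF d(1) exps_least[OF d]] ..
    also have "\<dots> = (\<Sum>(a, b)\<in>splits y'. nscale (scoeff (Wser q) a) (BBq q (int (n + deg a)) (hm b)))"
      by (simp add: H_mult_hm[where q = q] conv_def)
    also have "\<dots> \<in> nsym.span (range (Qprime q))"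
    proof (rule nsym.span_sum, clarify)
      fix a b assume "(a, b) \<in> splits y'"
      then have "deg b < deg y" using d by (auto simp: splits_def deg_add)
      from less[OF this] d(1)
      show "nscale (scoeff (Wser q) a) (BBq q (int (n + deg a)) (hm b)) \<in> nsym.span (range (Qprime q))"
        by (intro nsym.span_scale BBq_span) auto
    qed
    finally show ?thesis .
  qed
qed

text \<open>The pairings with the \<open>Qprime q \<beta>\<close> determine those with every
  \<open>hm y\<close> in their span, and these are all the coefficients of the series.\<close>

lemma dual_Qprime_eqI:
  assumes F: "F \<in> QSym" "\<And>\<beta>. pairing (Qprime q \<beta>) F = (if \<beta> = \<alpha> then 1 else 0)"
  shows "dual (Qprime q) \<alpha> = F"
  unfolding dual_def
proof (rule the_equality)
  fix G assume G: "G \<in> QSym \<and> (\<forall>\<beta>. pairing (Qprime q \<beta>) G = (if \<beta> = \<alpha> then 1 else 0))"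
  have eq: "pairing f G = pairing f F" if "f \<in> nsym.span (range (Qprime q))" for f
    using that
  proof (induction rule: nsym.span_induct_alt)
    case (step c x g)
    with F G show ?case by (auto simp: pairing_add nscale_def pairing_nconst)
  qed simp
  show "G = F"
  proof (rule series_eqI)
    fix y
    show "scoeff G y = scoeff F y"
      using eq[OF hm_span[of y]] F(1) G by (simp add: QSym_iff pairing_hm)
  qed
qed (use F in auto)

lemma calP_tabser: "calP q \<alpha> = tabser q (parts \<alpha>)"
  unfolding calP_def
  by (rule dual_Qprime_eqI) (use parts[of \<alpha>] in \<open>auto simp: pairing_Qprime intro: tabser_QSym\<close>)

text \<open>At \<open>q = 1\<close> the operators multiply by \<open>H\<close>, so the basis
  consists of the complete functions, to which the \<open>M \<alpha>\<close> are dual.\<close>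

lemma calP_1: "calP 1 \<alpha> = M \<alpha>"
  unfolding calP_def
proof (rule dual_Qprime_eqI[OF M_QSym])
  fix \<beta>
  have "foldr (\<lambda>a. BBq 1 (int a)) xs 1 = (\<Prod>a\<leftarrow>xs. H (int a) :: 'a nsym)" for xs
    by (induction xs) (simp_all add: BBq_1)
  then show "pairing (Qprime 1 \<beta>) (M \<alpha> :: 'a series) = (if \<beta> = \<alpha> then 1 else 0)"
    by (simp add: Qprime_def pairing_H_M)
qed

lemma calP_0: "calP 0 \<alpha> = dual_immaculate \<alpha>"
proof -
  have "BBq 0 = (BB :: int \<Rightarrow> 'a nsym \<Rightarrow> _)" by (intro ext) (rule BBq_0)
  then have "Qprime 0 = (immaculate :: _ \<Rightarrow> 'a nsym)"
    by (intro ext) (simp only: Qprime_def immaculate_def)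
  then show ?thesis by (simp add: calP_def dual_immaculate_def)
qed

section \<open>Specialization\<close>

text \<open>With the next lemmas: the functions regular at \<open>c\<close> form a ring on which
  evaluation is a homomorphism.\<close>

lemma value_at_add: "value_at c f v \<Longrightarrow> value_at c g w \<Longrightarrow> value_at c (f + g) (v + w)"
  unfolding value_at_def
proof clarify
  fix a b a' b' assume b: "poly b c \<noteq> 0" "poly b' c \<noteq> 0"
  then have "b \<noteq> 0" "b' \<noteq> 0" by auto
  with b show "\<exists>d e. Fract a b + Fract a' b' = Fract d e \<and> poly e c \<noteq> 0 \<and>
      poly a c / poly b c + poly a' c / poly b' c = poly d c / poly e c"
    by (intro exI[of _ "a * b' + a' * b"] exI[of _ "b * b'"]) (simp add: field_simps)
qed

lemma value_at_mult: "value_at c f v \<Longrightarrow> value_at c g w \<Longrightarrow> value_at c (f * g) (v * w)"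
  unfolding value_at_def
proof clarify
  fix a b a' b' assume "poly b c \<noteq> 0" "poly b' c \<noteq> 0"
  then show "\<exists>d e. Fract a b * Fract a' b' = Fract d e \<and> poly e c \<noteq> 0 \<and>
      poly a c / poly b c * (poly a' c / poly b' c) = poly d c / poly e c"
    by (intro exI[of _ "a * a'"] exI[of _ "b * b'"]) simp
qed

lemma value_at_poly: "value_at c (Fract p 1) (poly p c)"
  unfolding value_at_def by (intro exI[of _ p] exI[of _ 1]) simp

lemma value_at_0: "value_at c 0 0" and value_at_1: "value_at c 1 1"
  using value_at_poly[of c 0] value_at_poly[of c 1] by (simp_all flip: Zero_fract_def One_fract_def)

lemma value_at_1_minus_qvar: "value_at c (1 - qvar) (1 - c)"
proof -
  have "1 - qvar = Fract (1 - [:0, 1:]) 1" by (simp add: qvar_def One_fract_def)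
  then show ?thesis using value_at_poly[of c "1 - [:0, 1:]"] by simp
qed

lemma value_at_power: "value_at c f v \<Longrightarrow> value_at c (f ^ n) (v ^ n)"
  by (induction n) (simp_all add: value_at_1 value_at_mult)

lemma value_at_sum: "(\<And>x. x \<in> A \<Longrightarrow> value_at c (f x) (v x)) \<Longrightarrow> value_at c (sum f A) (sum v A)"
  by (induction A rule: infinite_finite_induct) (simp_all add: value_at_0 value_at_add)

text \<open>The coefficients are finite sums of powers of \<open>1 - qvar\<close>, so evaluating
  them gives the same tableau sums over the rationals with parameter \<open>c\<close>.\<close>

lemma calP_qvar_specializes: "specializes c (calP qvar \<alpha>) (calP c \<alpha>)"
  unfolding specializes_def calP_tabser tabser.rep_eq tabsum_def
  by (intro allI value_at_sum value_at_power value_at_1_minus_qvar)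

theorem theorem4p15:
  fixes \<alpha> :: composition
  shows "calP qvar \<alpha> = (\<Sum>T\<in>immaculate_tableaux \<alpha>. scale ((1 - qvar) ^ nT T) (M (tab_content T)))
    \<and> specializes 1 (calP qvar \<alpha>) (M \<alpha>)
    \<and> specializes 0 (calP qvar \<alpha>) (dual_immaculate \<alpha>)"
  using calP_qvar_specializes[of 1 \<alpha>] calP_qvar_specializes[of 0 \<alpha>]
  by (simp add: calP_1 calP_0) (simp add: calP_tabser tabser_tableaux)

end
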